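(* Let $n\geq 2$ and let $\eta^{\mathbb{C}}:=dz^1\wedge\dots\wedge dz^n$ be the standard holomorphic $n$-form on $\mathbb{C}^n$. Then $\eta^{\mathbb{C}}$ descends to $(\mathbb{C}^n\setminus\{0\})/\mu_n$, and $\eta:=\pi^*\eta^{\mathbb{C}}$ extends to a nowhere vanishing holomorphic volume form on $\mathcal{O}_{\mathbb{CP}^{n-1}}(-n)$ which is parallel with respect to the Ricci-flat Calabi-Eguchi-Hanson metric.
   Context: $\mu_n$ is the group of $n$-th roots of unity acting on $\mathbb{C}^n$ by scalar multiplication. The total space of $\mathcal{O}(-n)$ is $\mathcal{O}_{\mathbb{CP}^{n-1}}(-n)=\{(z,[\xi]) : z^i(\xi^j)^n=z^j(\xi^i)^n\ \forall i,j\}\subset\mathbb{C}^n\times\mathbb{CP}^{n-1}$, with zero section $\{(0,[\xi])\}\cong\mathbb{CP}^{n-1}$. The blow-down map $\pi:\mathcal{O}_{\mathbb{CP}^{n-1}}(-n)\to\mathbb{C}^n/\mu_n$ is given over $\{\xi^i\neq0\}$, with $\zeta^j=\xi^j/\xi^i$ and $t=z^i$ (so $z^j=(\zeta^j)^n t$), by $(z,[\xi])\mapsto[t^{1/n}(\zeta^1,\dots,\zeta^n)]$, where $\zeta^i=1$ and $t^{1/n}$ is any $n$-th root of $t$. It restricts to a biholomorphism $\mathcal{O}_{\mathbb{CP}^{n-1}}(-n)\setminus\mathbb{CP}^{n-1}\cong(\mathbb{C}^n\setminus\{0\})/\mu_n$. For a parameter $a>0$, the Calabi-Eguchi-Hanson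 metric is the Ricci-flat Kähler metric on $\mathcal{O}_{\mathbb{CP}^{n-1}}(-n)$ which, under this identification, is given on $(\mathbb{C}^n\setminus\{0\})/\mu_n$ in standard coordinates by $$g_{\mu\bar\nu}=\sqrt[n]{1+\frac{a^n}{u^n}}\left(\delta_{\mu\bar\nu}-\frac{a^n}{a^n+u^n}\frac{\bar z_\mu z_\nu}{u}\right),\qquad u=|z|^2_{\mathbb{C}^n},$$ where indices on $z$ are lowered with the Euclidean metric ($z_\nu=z^\nu$, $\bar z_\mu=\bar z^\mu$); it extends smoothly across the zero section. *)

theory Defs
  imports "HOL-Analysis.Analysis"
begin

section \<open>Tensor fields on manifolds given by an atlas\<close>

text \<open>A chart is a pair of a domain and a coordinate map. Only its values on the domain matter.\<close>

type_synonym ('p, 'v) chart = "'p set \<times> ('p \<Rightarrow> 'v)"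

definition chart_image :: "('p, 'v) chart \<Rightarrow> 'v set" where
  "chart_image c = snd c ` fst c"

definition chart_point :: "('p, 'v) chart \<Rightarrow> 'v \<Rightarrow> 'p" where
  "chart_point c = inv_into (fst c) (snd c)"

definition local_rep :: "('p, 'v) chart \<Rightarrow> ('q, 'w) chart \<Rightarrow> ('p \<Rightarrow> 'q) \<Rightarrow> 'v \<Rightarrow> 'w" where
  "local_rep c d F = snd d \<circ> F \<circ> chart_point c"

definition local_diff ::
  "('p, 'v::real_normed_vector) chart \<Rightarrow> ('q, 'w::real_normed_vector) chart \<Rightarrow> ('p \<Rightarrow> 'q) \<Rightarrow> 'p \<Rightarrow> 'v \<Rightarrow> 'w" where
  "local_diff c d F p = frechet_derivative (local_rep c d F) (at (snd c p))"

text \<open>Covariant tensor fields are given by their coordinate representations in all charts of an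
  atlas: \<open>\<omega> c x\<close> is the tensor at the point with coordinates \<open>x\<close> in the chart \<open>c\<close>. The arguments of
  a form of degree \<open>CARD('n)\<close> are indexed by \<open>'n\<close>, as are the coordinates.\<close>

type_synonym ('p, 'n) form =
  "('p, complex ^ 'n) chart \<Rightarrow> complex ^ 'n \<Rightarrow> ('n \<Rightarrow> complex ^ 'n) \<Rightarrow> complex"

type_synonym ('p, 'n) metric =
  "('p, complex ^ 'n) chart \<Rightarrow> complex ^ 'n \<Rightarrow> complex ^ 'n \<Rightarrow> complex ^ 'n \<Rightarrow> real"

text \<open>\<open>\<omega> = F\<^sup>* \<omega>'\<close> at the points of \<open>S\<close> that \<open>F\<close> maps into the manifold with atlas \<open>B\<close>. For
  \<open>A = B\<close>, \<open>F = id\<close> and \<open>\<omega> = \<omega>'\<close> this is the transformation law between the charts of \<open>A\<close>.\<close>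

definition form_pullback_on ::
  "'p set \<Rightarrow> ('p, complex ^ 'n::finite) chart set \<Rightarrow> ('q, complex ^ 'n) chart set \<Rightarrow> ('p \<Rightarrow> 'q) \<Rightarrow>
   ('p, 'n) form \<Rightarrow> ('q, 'n) form \<Rightarrow> bool" where
  "form_pullback_on S A B F \<omega> \<omega>' \<longleftrightarrow>
     (\<forall>c\<in>A. \<forall>d\<in>B. \<forall>p\<in>S \<inter> fst c. F p \<in> fst d \<longrightarrow>
       (\<forall>Y. \<omega> c (snd c p) Y = \<omega>' d (snd d (F p)) (\<lambda>k. local_diff c d F p (Y k))))"

definition metric_pullback_on ::
  "'p set \<Rightarrow> ('p, complex ^ 'n::finite) chart set \<Rightarrow> ('q, complex ^ 'n) chart set \<Rightarrow> ('p \<Rightarrow> 'q) \<Rightarrow>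
   ('p, 'n) metric \<Rightarrow> ('q, 'n) metric \<Rightarrow> bool" where
  "metric_pullback_on S A B F g g' \<longleftrightarrow>
     (\<forall>c\<in>A. \<forall>d\<in>B. \<forall>p\<in>S \<inter> fst c. F p \<in> fst d \<longrightarrow>
       (\<forall>X Y. g c (snd c p) X Y =
          g' d (snd d (F p)) (local_diff c d F p X) (local_diff c d F p Y)))"

text \<open>Smoothness on an open set: all iterated directional derivatives exist and are
  Frechet differentiable.\<close>

coinductive smooth_on :: "'a::real_normed_vector set \<Rightarrow> ('a \<Rightarrow> 'b::real_normed_vector) \<Rightarrow> bool"
  for S where
  "\<lbrakk>\<forall>x\<in>S. f differentiable at x; \<forall>v. smooth_on S (\<lambda>x. frechet_derivative f (at x) v)\<rbrakk>
   \<Longrightarrow> smooth_on S f"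

definition riemannian_metric :: "('p, complex ^ 'n::finite) chart set \<Rightarrow> ('p, 'n) metric \<Rightarrow> bool" where
  "riemannian_metric A g \<longleftrightarrow>
     metric_pullback_on UNIV A A id g g \<and>
     (\<forall>c\<in>A. \<forall>x\<in>chart_image c.
        bilinear (g c x) \<and> (\<forall>X Y. g c x X Y = g c x Y X) \<and> (\<forall>X. X \<noteq> 0 \<longrightarrow> g c x X X > 0)) \<and>
     (\<forall>c\<in>A. \<forall>X Y. smooth_on (chart_image c) (\<lambda>x. g c x X Y))"

definition holomorphic_fun_on :: "(complex ^ 'n::finite) set \<Rightarrow> (complex ^ 'n \<Rightarrow> complex) \<Rightarrow> bool" where
  "holomorphic_fun_on S f \<longleftrightarrow>
     (\<forall>x\<in>S. \<exists>L. (f has_derivative L) (at x) \<and> (\<forall>c v. L (c *s v) = c * L v))"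

definition complex_atlas :: "('p, complex ^ 'n::finite) chart set \<Rightarrow> bool" where
  "complex_atlas A \<longleftrightarrow>
     (\<forall>c\<in>A. inj_on (snd c) (fst c) \<and> open (chart_image c)) \<and>
     (\<forall>c\<in>A. \<forall>d\<in>A. open (snd c ` (fst c \<inter> fst d)) \<and>
        (\<forall>j. holomorphic_fun_on (snd c ` (fst c \<inter> fst d)) (\<lambda>x. local_rep c d id x $ j)))"

text \<open>\<open>(dw\<^sup>1 \<and> \<dots> \<and> dw\<^sup>n)(Y\<^sub>1, \<dots>, Y\<^sub>n) = det (dw\<^sup>j(Y\<^sub>k))\<close>\<close>

definition coord_volume :: "('n::finite \<Rightarrow> complex ^ 'n) \<Rightarrow> complex" where
  "coord_volume Y = det (\<chi> k. Y k)"

text \<open>A holomorphic form of top degree is \<open>f dw\<^sup>1 \<and> \<dots> \<and> dw\<^sup>n\<close> in each chart, with \<open>f\<close>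
  holomorphic.\<close>

definition holomorphic_volume_form ::
  "('p, complex ^ 'n::finite) chart set \<Rightarrow> ('p, 'n) form \<Rightarrow> bool" where
  "holomorphic_volume_form A \<omega> \<longleftrightarrow>
     form_pullback_on UNIV A A id \<omega> \<omega> \<and>
     (\<forall>c\<in>A. \<exists>f. holomorphic_fun_on (chart_image c) f \<and>
        (\<forall>x\<in>chart_image c. \<forall>Y. \<omega> c x Y = f x * coord_volume Y))"

definition nowhere_vanishing :: "('p, complex ^ 'n::finite) chart set \<Rightarrow> ('p, 'n) form \<Rightarrow> bool" where
  "nowhere_vanishing A \<omega> \<longleftrightarrow> (\<forall>c\<in>A. \<forall>x\<in>chart_image c. \<exists>Y. \<omega> c x Y \<noteq> 0)"

text \<open>The Levi-Civita connection in a chart: \<open>christoffel h x X Y\<close> is \<open>\<nabla>\<^sub>X Y\<close> at \<open>x\<close> for constant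
  vector fields \<open>X\<close> and \<open>Y\<close>, determined by the Koszul formula for the metric \<open>h\<close>. Here the
  coordinate space is regarded as a real vector space.\<close>

definition christoffel ::
  "('v::real_normed_vector \<Rightarrow> 'v \<Rightarrow> 'v \<Rightarrow> real) \<Rightarrow> 'v \<Rightarrow> 'v \<Rightarrow> 'v \<Rightarrow> 'v" where
  "christoffel h x X Y = (THE V. \<forall>Z.
     2 * h x V Z =
       frechet_derivative (\<lambda>y. h y Y Z) (at x) X
     + frechet_derivative (\<lambda>y. h y X Z) (at x) Y
     - frechet_derivative (\<lambda>y. h y X Y) (at x) Z)"

definition covariant_derivative ::
  "('v::real_normed_vector \<Rightarrow> 'v \<Rightarrow> 'v \<Rightarrow> real) \<Rightarrow> ('v \<Rightarrow> ('n::finite \<Rightarrow> 'v) \<Rightarrow> complex) \<Rightarrow>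
   'v \<Rightarrow> 'v \<Rightarrow> ('n \<Rightarrow> 'v) \<Rightarrow> complex" where
  "covariant_derivative h \<omega> x X Y =
     frechet_derivative (\<lambda>y. \<omega> y Y) (at x) X
     - (\<Sum>k\<in>UNIV. \<omega> x (Y(k := christoffel h x X (Y k))))"

definition parallel ::
  "('p, complex ^ 'n::finite) chart set \<Rightarrow> ('p, 'n) metric \<Rightarrow> ('p, 'n) form \<Rightarrow> bool" where
  "parallel A g \<omega> \<longleftrightarrow>
     (\<forall>c\<in>A. \<forall>x\<in>chart_image c. \<forall>X Y. covariant_derivative (g c) (\<omega> c) x X Y = 0)"


section \<open>The quotient of \<open>\<complex>\<^sup>n\<close> by the roots of unity\<close>

definition mu_rel :: "((complex ^ 'n::finite) \<times> (complex ^ 'n)) set" where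
  "mu_rel = {(x, y). \<exists>c. c ^ CARD('n) = 1 \<and> y = c *s x}"

definition mu_class :: "complex ^ 'n::finite \<Rightarrow> (complex ^ 'n) set" where
  "mu_class x = mu_rel `` {x}"

definition punctured_quotient :: "(complex ^ 'n::finite) set set" where
  "punctured_quotient = (- {0}) // mu_rel"

definition punctured_atlas :: "(complex ^ 'n::finite, complex ^ 'n) chart set" where
  "punctured_atlas = {(- {0}, id)}"

text \<open>The action is free away from the origin. The charts of the quotient are the local inverses
  of the projection, i.e. the standard coordinates.\<close>

definition quotient_atlas :: "((complex ^ 'n::finite) set, complex ^ 'n) chart set" where
  "quotient_atlas =
     {(mu_class ` V, inv_into V mu_class) | V. open V \<and> 0 \<notin> V \<and> inj_on mu_class V}"

definition standard_volume :: "('p, 'n::finite) form" where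
  "standard_volume c z Y = coord_volume Y"


section \<open>The total space of \<open>\<O>(-n)\<close> and the blow-down map\<close>

definition proj_rel :: "((complex ^ 'n::finite) \<times> (complex ^ 'n)) set" where
  "proj_rel = {(x, y). \<exists>c. c \<noteq> 0 \<and> y = c *s x}"

definition proj_class :: "complex ^ 'n::finite \<Rightarrow> (complex ^ 'n) set" where
  "proj_class \<xi> = proj_rel `` {\<xi>}"

definition projective_space :: "(complex ^ 'n::finite) set set" where
  "projective_space = (- {0}) // proj_rel"

definition total_space :: "((complex ^ 'n::finite) \<times> (complex ^ 'n) set) set" where
  "total_space = {(z, P). P \<in> projective_space \<and>
     (\<forall>\<xi>\<in>P. \<forall>i j. z $ i * (\<xi> $ j) ^ CARD('n) = z $ j * (\<xi> $ i) ^ CARD('n))}"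

definition zero_section :: "((complex ^ 'n::finite) \<times> (complex ^ 'n) set) set" where
  "zero_section = {(z, P) \<in> total_space. z = 0}"

definition chart_domain :: "'n::finite \<Rightarrow> ((complex ^ 'n) \<times> (complex ^ 'n) set) set" where
  "chart_domain i = {(z, P) \<in> total_space. \<forall>\<xi>\<in>P. \<xi> $ i \<noteq> 0}"

text \<open>The affine coordinates \<open>\<zeta>\<^sup>j = \<xi>\<^sup>j / \<xi>\<^sup>i\<close> of \<open>P = [\<xi>]\<close> are those of its representative with
  \<open>\<zeta>\<^sup>i = 1\<close>.\<close>

definition affine_rep :: "'n::finite \<Rightarrow> (complex ^ 'n) set \<Rightarrow> complex ^ 'n" where
  "affine_rep i P = (THE \<zeta>. \<zeta> \<in> P \<and> \<zeta> $ i = 1)"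

text \<open>The coordinates on \<open>{\<xi>\<^sup>i \<noteq> 0}\<close> are \<open>\<zeta>\<^sup>j\<close> for \<open>j \<noteq> i\<close>, and \<open>t = z\<^sup>i\<close> in position \<open>i\<close>.\<close>

definition chart_coord :: "'n::finite \<Rightarrow> (complex ^ 'n) \<times> (complex ^ 'n) set \<Rightarrow> complex ^ 'n" where
  "chart_coord i = (\<lambda>(z, P). \<chi> j. if j = i then z $ i else affine_rep i P $ j)"

definition total_atlas :: "((complex ^ 'n::finite) \<times> (complex ^ 'n) set, complex ^ 'n) chart set" where
  "total_atlas = (\<lambda>i. (chart_domain i, chart_coord i)) ` UNIV"

text \<open>Lemma \<open>blowdown_eq\<close> shows that the result is independent of the chart and of the choice of
  the root \<open>s = t\<^bsup>1/n\<^esup>\<close>.\<close>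

definition blowdown :: "(complex ^ 'n::finite) \<times> (complex ^ 'n) set \<Rightarrow> (complex ^ 'n) set" where
  "blowdown = (\<lambda>(z, P). THE q. \<forall>i s. (z, P) \<in> chart_domain i \<and> s ^ CARD('n) = z $ i \<longrightarrow>
     q = mu_class (s *s affine_rep i P))"


section \<open>The Calabi-Eguchi-Hanson metric\<close>

definition ceh_coeff :: "real \<Rightarrow> complex ^ 'n::finite \<Rightarrow> 'n \<Rightarrow> 'n \<Rightarrow> complex" where
  "ceh_coeff a z \<mu> \<nu> = (let n = CARD('n); u = (norm z)\<^sup>2 in
     of_real (root n (1 + a ^ n / u ^ n)) *
     ((if \<mu> = \<nu> then 1 else 0) -
      of_real (a ^ n / (a ^ n + u ^ n)) * (cnj (z $ \<mu>) * z $ \<nu> / of_real u)))"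

text \<open>The Riemannian metric of the Hermitian matrix, normalised such that the identity matrix gives
  the Euclidean metric.\<close>

definition ceh_standard :: "real \<Rightarrow> complex ^ 'n::finite \<Rightarrow> complex ^ 'n \<Rightarrow> complex ^ 'n \<Rightarrow> real" where
  "ceh_standard a z X Y =
     Re (\<Sum>\<mu>\<in>UNIV. \<Sum>\<nu>\<in>UNIV. ceh_coeff a z \<mu> \<nu> * X $ \<mu> * cnj (Y $ \<nu>))"

text \<open>A smooth metric on the total space that is given by the above formula off the zero section;
  it is unique by density, and exists by lemma \<open>ceh_metric_exists\<close>. Its restriction is compared with the formula in every
  local inverse of the projection to the quotient.\<close>

definition ceh_metric :: "real \<Rightarrow> ((complex ^ 'n::finite) \<times> (complex ^ 'n) set, 'n) metric \<Rightarrow> bool" where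
  "ceh_metric a g \<longleftrightarrow>
     riemannian_metric total_atlas g \<and>
     metric_pullback_on (total_space - zero_section) total_atlas quotient_atlas blowdown
       g (\<lambda>c. ceh_standard a)"


section \<open>Consistency of the definitions\<close>

definition affine_point :: "'n::finite \<Rightarrow> complex ^ 'n \<Rightarrow> complex ^ 'n" where
  "affine_point i w = (\<chi> j. if j = i then 1 else w $ j)"

definition total_point :: "'n::finite \<Rightarrow> complex ^ 'n \<Rightarrow> (complex ^ 'n) \<times> (complex ^ 'n) set" where
  "total_point i w = ((\<chi> j. w $ i * affine_point i w $ j ^ CARD('n)), proj_class (affine_point i w))"

lemma proj_class_iff: "y \<in> proj_class (x) \<longleftrightarrow> (\<exists>c. c \<noteq> 0 \<and> y = c *s x)"
  by (auto simp: proj_class_def proj_rel_def)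

lemma mu_class_iff: "y \<in> mu_class (x :: complex ^ 'n::finite) \<longleftrightarrow> (\<exists>c. c ^ CARD('n) = 1 \<and> y = c *s x)"
  by (auto simp: mu_class_def mu_rel_def)

lemma mu_class_scale:
  assumes "c ^ CARD('n) = 1"
  shows "mu_class (c *s (x :: complex ^ 'n::finite)) = mu_class x"
proof (rule set_eqI)
  fix y
  have c: "c \<noteq> 0" using assms by (auto simp: power_0_left)
  have "\<exists>d. d ^ CARD('n) = 1 \<and> y = d *s x" if "e ^ CARD('n) = 1" "y = e *s (c *s x)" for e
    using that assms by (intro exI[of _ "e * c"]) (auto simp: power_mult_distrib vector_smult_assoc)
  moreover have "\<exists>e. e ^ CARD('n) = 1 \<and> y = e *s (c *s x)" if "d ^ CARD('n) = 1" "y = d *s x" for d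
    using that assms c by (intro exI[of _ "d / c"]) (auto simp: power_divide vector_smult_assoc)
  ultimately show "y \<in> mu_class (c *s x) \<longleftrightarrow> y \<in> mu_class x"
    by (auto simp: mu_class_iff)
qed

lemma mu_class_eq_iff:
  "mu_class (x :: complex ^ 'n::finite) = mu_class y \<longleftrightarrow> (\<exists>c. c ^ CARD('n) = 1 \<and> y = c *s x)"
proof
  assume "mu_class x = mu_class y"
  moreover have "y \<in> mu_class y" by (auto simp: mu_class_iff intro!: exI[of _ 1])
  ultimately show "\<exists>c. c ^ CARD('n) = 1 \<and> y = c *s x" by (metis mu_class_iff)
qed (auto simp: mu_class_scale)

lemma affine_rep_class:
  assumes "\<xi> $ i \<noteq> 0"
  shows "affine_rep i (proj_class (\<xi>)) = inverse (\<xi> $ i) *s \<xi>"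
  unfolding affine_rep_def
proof (rule the_equality)
  show "inverse (\<xi> $ i) *s \<xi> \<in> proj_class (\<xi>) \<and> (inverse (\<xi> $ i) *s \<xi>) $ i = 1"
    using assms by (auto simp: proj_class_iff intro!: exI[of _ "inverse (\<xi> $ i)"])
next
  fix \<zeta> assume "\<zeta> \<in> proj_class (\<xi>) \<and> \<zeta> $ i = 1"
  then obtain c where "\<zeta> = c *s \<xi>" "c * \<xi> $ i = 1"
    unfolding proj_class_iff by (metis vector_smult_component)
  then show "\<zeta> = inverse (\<xi> $ i) *s \<xi>" using assms by (simp add: field_simps)
qed

lemma proj_class_scale:
  assumes "c \<noteq> 0"
  shows "proj_class (c *s \<xi>) = proj_class (\<xi>)"
proof (rule set_eqI)
  fix y
  have "\<exists>d. d \<noteq> 0 \<and> y = d *s \<xi>" if "e \<noteq> 0" "y = e *s (c *s \<xi>)" for e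
    using that assms by (intro exI[of _ "e * c"]) (auto simp: vector_smult_assoc)
  moreover have "\<exists>e. e \<noteq> 0 \<and> y = e *s (c *s \<xi>)" if "d \<noteq> 0" "y = d *s \<xi>" for d
    using that assms by (intro exI[of _ "d / c"]) (auto simp: vector_smult_assoc)
  ultimately show "y \<in> proj_class (c *s \<xi>) \<longleftrightarrow> y \<in> proj_class (\<xi>)"
    by (auto simp: proj_class_iff)
qed

lemma proj_class_in_space: "\<xi> \<noteq> 0 \<Longrightarrow> proj_class (\<xi>) \<in> projective_space"
  by (auto simp: projective_space_def quotient_def proj_class_def[symmetric])

lemma affine_point_self [simp]: "affine_point i w $ i = 1"
  by (simp add: affine_point_def)

lemma affine_point_nz [simp]: "affine_point i w \<noteq> 0"
  by (metis affine_point_self zero_index zero_neq_one)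

lemma affine_rep_total_point [simp]:
  "affine_rep i (proj_class (affine_point i w)) = affine_point i w"
  by (simp add: affine_rep_class)

lemma total_point_in: "total_point i w \<in> chart_domain k \<longleftrightarrow> affine_point i w $ k \<noteq> 0"
proof -
  have "total_point i w \<in> total_space"
    by (auto simp: total_space_def total_point_def proj_class_in_space proj_class_iff power_mult_distrib)
  moreover have "affine_point i w \<in> proj_class (affine_point i w)"
    unfolding proj_class_iff by (intro exI[of _ 1]) auto
  then have "(\<forall>\<xi>\<in>proj_class (affine_point i w). \<xi> $ k \<noteq> 0) \<longleftrightarrow> affine_point i w $ k \<noteq> 0"
    by (metis (no_types, lifting) mult_eq_0_iff proj_class_iff vector_smult_component)
  ultimately show ?thesis
    by (simp add: chart_domain_def total_point_def)
qed

lemma chart_total_point: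
  fixes i :: "'n::finite"
  assumes "affine_point i w $ k \<noteq> 0"
  shows "chart_coord k (total_point i w) =
    (\<chi> j. if j = k then w $ i * affine_point i w $ k ^ CARD('n)
          else affine_point i w $ j / affine_point i w $ k)"
  using assms by (simp add: chart_coord_def total_point_def affine_rep_class divide_inverse mult.commute
      cong: if_cong)

lemma chart_total_point_self [simp]: "chart_coord i (total_point i w) = w"
  by (simp add: chart_total_point) (simp add: vec_eq_iff affine_point_def)

lemma total_point_chart:
  assumes "p \<in> chart_domain i"
  shows "total_point i (chart_coord i p) = p"
proof -
  obtain z P where p: "p = (z, P)" by force
  from assms p obtain \<xi> where P: "P = proj_class (\<xi>)" "\<xi> \<noteq> 0"
    by (auto simp: chart_domain_def total_space_def projective_space_def quotient_def proj_class_def[symmetric])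
  have "\<xi> \<in> P" unfolding P proj_class_iff by (intro exI[of _ 1]) auto
  with assms p have nz: "\<xi> $ i \<noteq> 0" and eq: "\<And>j. z $ i * (\<xi> $ j) ^ CARD('a) = z $ j * (\<xi> $ i) ^ CARD('a)"
    by (auto simp: chart_domain_def total_space_def)
  have aff: "affine_point i (chart_coord i p) = inverse (\<xi> $ i) *s \<xi>"
    using nz by (auto simp: p chart_coord_def P affine_rep_class affine_point_def vec_eq_iff)
  show ?thesis
    unfolding total_point_def aff using nz eq
    by (auto simp: p P proj_class_scale chart_coord_def vec_eq_iff power_mult_distrib power_inverse field_simps)
qed

lemma chart_point_total: "chart_point (chart_domain i, chart_coord i) = total_point i"
proof
  fix w
  have "inj_on (chart_coord i) (chart_domain i)"
    by (metis inj_onI total_point_chart)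
  moreover have "total_point i w \<in> chart_domain i" by (simp add: total_point_in)
  ultimately show "chart_point (chart_domain i, chart_coord i) w = total_point i w"
    unfolding chart_point_def by (metis chart_total_point_self fst_conv inv_into_f_f snd_conv)
qed

lemma chart_image_total: "chart_image (chart_domain i, chart_coord i) = UNIV"
proof -
  have "w \<in> chart_coord i ` chart_domain i" for w
    by (rule image_eqI[of _ _ "total_point i w"]) (auto simp: total_point_in)
  then show ?thesis by (auto simp: chart_image_def)
qed

lemma total_atlas_covers: "\<Union> (fst ` total_atlas) = total_space"
proof -
  have "\<exists>i. p \<in> chart_domain i" if "p \<in> total_space" for p :: "(complex ^ 'n) \<times> (complex ^ 'n) set"
  proof -
    obtain z P where p: "p = (z, P)" by force
    with that obtain \<xi> where P: "P = proj_class (\<xi>)" "\<xi> \<noteq> 0"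
      by (auto simp: total_space_def projective_space_def quotient_def proj_class_def[symmetric])
    then obtain i where "\<xi> $ i \<noteq> 0" by (auto simp: vec_eq_iff)
    then show ?thesis using that by (auto simp: chart_domain_def p P proj_class_iff intro!: exI[of _ i])
  qed
  then show ?thesis by (force simp: total_atlas_def chart_domain_def)
qed

lemma blowdown_eq:
  fixes z :: "complex ^ 'n::finite"
  assumes "(z, P) \<in> chart_domain i" "s ^ CARD('n) = z $ i"
  shows "blowdown (z, P) = mu_class (s *s affine_rep i P)"
proof -
  have indep: "mu_class (s *s affine_rep i P) = mu_class (s' *s affine_rep k P)"
    if 1: "(z, P) \<in> chart_domain i" "s ^ CARD('n) = z $ i"
    and 2: "(z, P) \<in> chart_domain k" "s' ^ CARD('n) = z $ k" for i k s s'
  proof -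
    obtain \<xi> where P: "P = proj_class (\<xi>)" "\<xi> \<noteq> 0"
      using 1 by (auto simp: chart_domain_def total_space_def projective_space_def quotient_def proj_class_def[symmetric])
    have "\<xi> \<in> P" unfolding P proj_class_iff by (intro exI[of _ 1]) auto
    with 1 2 have nz: "\<xi> $ i \<noteq> 0" "\<xi> $ k \<noteq> 0"
      and eq: "z $ i * (\<xi> $ k) ^ CARD('n) = z $ k * (\<xi> $ i) ^ CARD('n)"
      by (auto simp: chart_domain_def total_space_def)
    have eq': "(s * \<xi> $ k) ^ CARD('n) = (s' * \<xi> $ i) ^ CARD('n)"
      using eq 1(2) 2(2) by (simp add: power_mult_distrib)
    define c where "c = (if s = 0 then 1 else (s' * \<xi> $ i) / (s * \<xi> $ k))"
    have c: "c ^ CARD('n) = 1" "s' * \<xi> $ i = c * (s * \<xi> $ k)"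
      using eq' nz by (auto simp: c_def power_divide power_0_left)
    have "s' *s affine_rep k P = c *s (s *s affine_rep i P)"
      using nz c(2) by (auto simp: P affine_rep_class vec_eq_iff field_simps)
    then show ?thesis using mu_class_scale[OF c(1)] by metis
  qed
  show ?thesis
    unfolding blowdown_def prod.case
  proof (rule the_equality)
    show "\<forall>k s'. (z, P) \<in> chart_domain k \<and> s' ^ CARD('n) = z $ k \<longrightarrow>
        mu_class (s *s affine_rep i P) = mu_class (s' *s affine_rep k P)"
      using indep assms by blast
  qed (use assms in blast)
qed

lemma blowdown_total_point:
  fixes w :: "complex ^ 'n::finite"
  shows "s ^ CARD('n) = w $ i \<Longrightarrow> blowdown (total_point i w) = mu_class (s *s affine_point i w)"
  using blowdown_eq[of "fst (total_point i w)" "snd (total_point i w)" i s] total_point_in[of i w i]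
  by (simp add: total_point_def)

definition herm :: "complex ^ 'n::finite \<Rightarrow> complex ^ 'n \<Rightarrow> complex" where
  "herm x y = (\<Sum>j\<in>UNIV. x $ j * cnj (y $ j))"

lemma herm_simps:
  "herm (x + x') y = herm x y + herm x' y" "herm x (y + y') = herm x y + herm x y'"
  "herm (c *s x) y = c * herm x y" "herm x (c *s y) = cnj c * herm x y"
  "herm (x - x') y = herm x y - herm x' y" "herm x (y - y') = herm x y - herm x y'"
  by (simp_all add: herm_def algebra_simps sum.distrib sum_distrib_left sum_subtractf)

lemma herm_cnj: "cnj (herm x y) = herm y x"
  by (simp add: herm_def mult.commute)

lemma herm_self: "herm x x = of_real ((norm x)\<^sup>2)"
  by (simp add: herm_def norm_vec_def L2_set_def sum_nonneg complex_norm_square[symmetric] del: of_real_power)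

lemma herm_cauchy_schwarz: "norm (herm x y) \<le> norm x * norm y"
proof -
  have "norm (herm x y) \<le> (\<Sum>j\<in>UNIV. norm (x $ j) * norm (y $ j))"
    unfolding herm_def by (rule sum_norm_le) (simp add: norm_mult)
  also have "\<dots> \<le> norm x * norm y"
    unfolding norm_vec_def by (rule order_trans[OF _ L2_set_mult_ineq]) simp
  finally show ?thesis .
qed

text \<open>The Fubini-Study form, pulled back to the complement of the origin.\<close>

definition fs :: "complex ^ 'n::finite \<Rightarrow> complex ^ 'n \<Rightarrow> complex ^ 'n \<Rightarrow> complex" where
  "fs v x y = herm x y / herm v v - herm x v * herm v y / (herm v v)\<^sup>2"

lemma fs_scale:
  assumes "v \<noteq> 0" "c \<noteq> 0"
  shows "fs (c *s v) (c *s x + a *s v) (c *s y + b *s v) = fs v x y"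
proof -
  have "herm v v \<noteq> 0" using assms by (simp add: herm_self)
  then show ?thesis using assms
    by (simp add: fs_def herm_simps divide_simps power2_eq_square) (simp add: algebra_simps)
qed

text \<open>With \<open>t = w\<^sup>i\<close> and \<open>h = |\<zeta>|\<^sup>2\<close>, the metric in the chart \<open>i\<close> is
  \<open>\<rho>\<^bsup>1/n\<^esup> FS + \<rho>\<^bsup>1/n - 1\<^esup> h\<^sup>n |\<theta>|\<^sup>2\<close>, where \<open>\<rho> = a\<^sup>n + |t|\<^sup>2 h\<^sup>n\<close> and
  \<open>\<theta> = dt/n + t \<partial>h/h\<close>. This makes sense for \<open>t = 0\<close>.\<close>

definition fibre_form :: "'n::finite \<Rightarrow> complex ^ 'n \<Rightarrow> complex ^ 'n \<Rightarrow> complex" where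
  "fibre_form i w x =
     x $ i / of_nat CARD('n) + w $ i * herm (x - x $ i *s axis i 1) (affine_point i w) / herm (affine_point i w) (affine_point i w)"

definition ceh_radius :: "real \<Rightarrow> 'n::finite \<Rightarrow> complex ^ 'n \<Rightarrow> real" where
  "ceh_radius a i w = a ^ CARD('n) + Re (w $ i * cnj (w $ i) * herm (affine_point i w) (affine_point i w) ^ CARD('n))"

definition ceh_hermitian :: "real \<Rightarrow> 'n::finite \<Rightarrow> complex ^ 'n \<Rightarrow> complex ^ 'n \<Rightarrow> complex ^ 'n \<Rightarrow> complex" where
  "ceh_hermitian a i w x y =
     of_real (ceh_radius a i w powr (1 / CARD('n))) *
       fs (affine_point i w) (x - x $ i *s axis i 1) (y - y $ i *s axis i 1) +
     of_real (ceh_radius a i w powr (1 / CARD('n) - 1)) *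
       herm (affine_point i w) (affine_point i w) ^ CARD('n) * fibre_form i w x * cnj (fibre_form i w y)"

lemma ceh_radius_eq: "ceh_radius a i (w :: complex ^ 'n::finite) = a ^ CARD('n) + (norm (w $ i))\<^sup>2 * ((norm (affine_point i w))\<^sup>2) ^ CARD('n)"
  unfolding ceh_radius_def herm_self complex_norm_square[symmetric] of_real_power[symmetric] of_real_mult[symmetric] Re_complex_of_real ..

lemma ceh_radius_pos: "a > 0 \<Longrightarrow> ceh_radius a i w > 0"
  unfolding ceh_radius_eq by (intro add_pos_nonneg) auto

definition ceh_chart :: "real \<Rightarrow> ((complex ^ 'n::finite) \<times> (complex ^ 'n) set, 'n) metric" where
  "ceh_chart a c w x y = Re (ceh_hermitian a (SOME i. c = (chart_domain i, chart_coord i)) w x y)"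

lemma chart_domain_inj: "chart_domain i = chart_domain j \<longleftrightarrow> i = j"
proof
  assume eq: "chart_domain i = chart_domain j"
  have "total_point i 0 \<in> chart_domain i" by (simp add: total_point_in)
  with eq show "i = j" by (auto simp: total_point_in affine_point_def split: if_splits)
qed simp

lemma ceh_chart_eq [simp]:
  "ceh_chart a (chart_domain i, chart_coord i) w x y = Re (ceh_hermitian a i w x y)"
proof -
  have "(SOME k. (chart_domain i, chart_coord i) = (chart_domain k, chart_coord k)) = i"
    by (rule some_equality) (auto simp: chart_domain_inj)
  then show ?thesis by (simp add: ceh_chart_def)
qed

subsection \<open>Agreement with the standard formula\<close>

lemma ceh_standard_eq:
  fixes z :: "complex ^ 'n::finite"
  shows "ceh_standard a z X Y =
    Re (of_real (root CARD('n) (1 + a ^ CARD('n) / ((norm z)\<^sup>2) ^ CARD('n))) *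
      (herm X Y - of_real (a ^ CARD('n) / (a ^ CARD('n) + ((norm z)\<^sup>2) ^ CARD('n))) *
         (herm X z * herm z Y / of_real ((norm z)\<^sup>2))))"
proof -
  have *: "(\<Sum>\<mu>\<in>UNIV. \<Sum>\<nu>\<in>UNIV. r * ((if \<mu> = \<nu> then 1 else 0) - q * (cnj (z $ \<mu>) * z $ \<nu> / u)) * X $ \<mu> * cnj (Y $ \<nu>))
     = r * (herm X Y - q * (herm X z * herm z Y / u))" (is "?L = ?R") for r q u :: complex
  proof -
    have "?L = (\<Sum>\<mu>\<in>UNIV. \<Sum>\<nu>\<in>UNIV. (if \<mu> = \<nu> then r * X $ \<mu> * cnj (Y $ \<mu>) else 0)
        - (r * q / u) * ((X $ \<mu> * cnj (z $ \<mu>)) * (z $ \<nu> * cnj (Y $ \<nu>))))"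
      by (intro sum.cong refl) (auto simp: algebra_simps)
    also have "\<dots> = r * herm X Y - (r * q / u) * (herm X z * herm z Y)"
      unfolding sum_subtractf sum_distrib_left[symmetric] herm_def sum_product
      by (simp add: sum_distrib_left mult.assoc)
    finally show ?thesis by (simp add: algebra_simps)
  qed
  show ?thesis
    unfolding ceh_standard_def ceh_coeff_def Let_def using * by metis
qed

lemma ceh_standard_pullback:
  fixes w :: "complex ^ 'n::finite"
  assumes a: "a > 0" and s: "s ^ CARD('n) = w $ i" and t: "w $ i \<noteq> 0"
  defines "dz \<equiv> \<lambda>x. s *s (x - x $ i *s axis i 1) + (s * (x $ i / (of_nat CARD('n) * w $ i))) *s affine_point i w"
  shows "ceh_standard a (s *s affine_point i w) (dz x) (dz y) = Re (ceh_hermitian a i w x y)"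
proof -
  let ?n = "CARD('n)"
  define v where "v = affine_point i w"
  define z where "z = s *s v"
  define u where "u = (norm z)\<^sup>2"
  define h where "h = (norm v)\<^sup>2"
  have s0: "s \<noteq> 0" using s t by (auto simp: power_0_left)
  have v0: "v \<noteq> 0" by (simp add: v_def)
  have h0: "h > 0" using v0 by (simp add: h_def)
  have z0: "z \<noteq> 0" using s0 v0 by (simp add: z_def)
  have u0: "u > 0" using z0 by (simp add: u_def)
  have hz: "herm z z = of_real u" and hv: "herm v v = of_real h"
    unfolding u_def h_def by (rule herm_self)+
  have "of_real u = (of_real ((norm s)\<^sup>2 * h) :: complex)"
    unfolding hz[symmetric] z_def herm_simps hv of_real_mult complex_norm_square by simp
  then have uh: "u = (norm s)\<^sup>2 * h" unfolding of_real_eq_iff .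
  have un: "u ^ ?n = (norm (w $ i))\<^sup>2 * h ^ ?n"
    by (simp add: uh power_mult_distrib s[symmetric] norm_power power_mult[symmetric] mult.commute)
  have rad: "ceh_radius a i w = a ^ ?n + u ^ ?n"
    unfolding ceh_radius_eq un h_def v_def ..
  define R where "R = a ^ ?n + u ^ ?n"
  have R0: "R > 0" using a u0 by (simp add: R_def add_pos_pos)
  have un0: "u ^ ?n > 0" using u0 by simp
  have root: "root ?n (1 + a ^ ?n / u ^ ?n) = R powr (1 / ?n) / u"
  proof -
    have "1 + a ^ ?n / u ^ ?n = R / u ^ ?n" using u0 by (simp add: R_def add_divide_distrib)
    then show ?thesis using R0 u0 by (simp add: real_root_divide root_powr_inverse[symmetric] real_root_power_cancel)
  qed
  have Rm: "R powr (1 / ?n - 1) = R powr (1 / ?n) / R"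
    using R0 by (simp add: powr_diff)
  have fs: "fs z (dz x) (dz y) = fs v (x - x $ i *s axis i 1) (y - y $ i *s axis i 1)" for x y
    unfolding z_def dz_def v_def[symmetric] using v0 s0 by (rule fs_scale)
  have th: "herm (dz x) z / of_real u = fibre_form i w x / w $ i" for x
  proof -
    have "herm (dz x) z = (s * cnj s) * (herm (x - x $ i *s axis i 1) v + x $ i / (of_nat ?n * w $ i) * of_real h)"
      unfolding dz_def z_def v_def[symmetric] herm_simps hv by (simp add: algebra_simps)
    moreover have "of_real u = (s * cnj s) * (of_real h :: complex)"
      unfolding uh of_real_mult complex_norm_square ..
    ultimately show ?thesis using s0 h0 t
      unfolding fibre_form_def v_def[symmetric] hv by (simp add: field_simps)
  qed
  have "of_real (R powr (1 / ?n) / u) * (herm (dz x) (dz y) - of_real (a ^ ?n / R) * (herm (dz x) z * herm z (dz y) / of_real u))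
     = of_real (R powr (1 / ?n)) * (fs z (dz x) (dz y) + of_real (u ^ ?n / R) * (herm (dz x) z / of_real u) * cnj (herm (dz y) z / of_real u))"
  proof -
    have an: "a ^ ?n = R - u ^ ?n" by (simp add: R_def)
    have "complex_of_real u \<noteq> 0" "complex_of_real R \<noteq> 0" using u0 R0 by auto
    then show ?thesis
      unfolding fs_def hz an complex_cnj_divide herm_cnj complex_cnj_complex_of_real of_real_divide of_real_diff
      by (simp add: divide_simps power2_eq_square) (simp add: algebra_simps)
  qed
  also have "\<dots> = ceh_hermitian a i w x y"
  proof -
    have "of_real (u ^ ?n / R) * (fibre_form i w x / w $ i) * cnj (fibre_form i w y / w $ i)
      = of_real (h ^ ?n / R) * fibre_form i w x * cnj (fibre_form i w y)"
      unfolding un using t by (simp add: complex_norm_square field_simps del: of_real_power flip: of_real_power)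
    then show ?thesis
      unfolding fs th ceh_hermitian_def rad R_def[symmetric] Rm v_def[symmetric] hv
      by (simp add: algebra_simps)
  qed
  finally show ?thesis
    unfolding ceh_standard_eq v_def[symmetric] z_def[symmetric] u_def[symmetric] root
    by (simp add: R_def)
qed

lemma has_derivative_vecI:
  fixes f :: "'a::real_normed_vector \<Rightarrow> complex ^ 'n::finite"
  assumes "\<And>j. ((\<lambda>x. f x $ j) has_derivative (\<lambda>v. L v $ j)) (at x)"
  shows "(f has_derivative L) (at x)"
proof (subst has_derivative_componentwise_within, intro ballI)
  fix b :: "complex ^ 'n" assume "b \<in> Basis"
  then obtain j c where b: "b = axis j c" by (auto simp: Basis_vec_def)
  show "((\<lambda>x. f x \<bullet> b) has_derivative (\<lambda>v. L v \<bullet> b)) (at x)"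
    unfolding b inner_axis by (intro has_derivative_inner_left assms)
qed

lemma nth_deriv: "((\<lambda>w :: complex ^ 'n::finite. w $ i) has_derivative (\<lambda>x. x $ i)) (at w)"
  by (intro bounded_linear_imp_has_derivative bounded_linear_vec_nth)

lemma affine_point_deriv:
  fixes w :: "complex ^ 'n::finite"
  shows "((\<lambda>w. affine_point i w $ j) has_derivative (\<lambda>x. (x - x $ i *s axis i 1) $ j)) (at w)"
proof (cases "j = i")
  case True
  then have "(\<lambda>w :: complex ^ 'n. affine_point i w $ j) = (\<lambda>_. 1)" "(\<lambda>x :: complex ^ 'n. (x - x $ i *s axis i 1) $ j) = (\<lambda>_. 0)"
    by auto
  then show ?thesis by simp
next
  case False
  then have "(\<lambda>w :: complex ^ 'n. affine_point i w $ j) = (\<lambda>w. w $ j)" "(\<lambda>x :: complex ^ 'n. (x - x $ i *s axis i 1) $ j) = (\<lambda>x. x $ j)"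
    by (auto simp: affine_point_def axis_def)
  then show ?thesis by (simp add: nth_deriv)
qed

lemma blowdown_local_rep:
  fixes w :: "complex ^ 'n::finite"
  assumes d: "d \<in> quotient_atlas" and t: "w $ i \<noteq> 0" and q: "blowdown (total_point i w) \<in> fst d"
  obtains s where "s ^ CARD('n) = w $ i" "snd d (blowdown (total_point i w)) = s *s affine_point i w"
    "(local_rep (chart_domain i, chart_coord i) d blowdown has_derivative
      (\<lambda>x. s *s (x - x $ i *s axis i 1) + (s * (x $ i / (of_nat CARD('n) * w $ i))) *s affine_point i w)) (at w)"
proof -
  let ?n = "CARD('n)"
  from d obtain V where V: "d = (mu_class ` V, inv_into V mu_class)" "open V" "inj_on mu_class V"
    by (auto simp: quotient_atlas_def)
  from q V obtain v0 where v0: "v0 \<in> V" "blowdown (total_point i w) = mu_class v0" by auto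
  have "exp (Ln (w $ i) / of_nat ?n) ^ ?n = w $ i"
    using t by (simp add: exp_of_nat_mult[symmetric])
  then obtain s1 where s1: "s1 ^ ?n = w $ i" by blast
  from v0(2) blowdown_total_point[OF s1] obtain c where c: "c ^ ?n = 1" "v0 = c *s (s1 *s affine_point i w)"
    by (metis mu_class_eq_iff)
  define s where "s = c * s1"
  have s: "s ^ ?n = w $ i" "v0 = s *s affine_point i w"
    using c s1 by (simp_all add: s_def power_mult_distrib)
  define \<sigma> where "\<sigma> t = s * exp (Ln (t / w $ i) / of_nat ?n)" for t
  define G where "G w' = \<sigma> (w' $ i) *s affine_point i w'" for w'
  have \<sigma>_pow: "\<sigma> u ^ ?n = u" if "u \<noteq> 0" for u
    using that t s by (simp add: \<sigma>_def power_mult_distrib exp_of_nat_mult[symmetric])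
  have \<sigma>0: "\<sigma> (w $ i) = s" using t by (simp add: \<sigma>_def)
  have "(\<sigma> has_field_derivative s / (of_nat ?n * w $ i)) (at (w $ i))"
    unfolding \<sigma>_def using t by (auto intro!: derivative_eq_intros)
  then have "((\<lambda>w'. \<sigma> (w' $ i)) has_derivative (\<lambda>x. s / (of_nat ?n * w $ i) * x $ i)) (at w)"
    unfolding has_field_derivative_def
    by (rule has_derivative_compose[OF nth_deriv])
  note \<sigma>' = this
  have G': "(G has_derivative
      (\<lambda>x. s *s (x - x $ i *s axis i 1) + (s * (x $ i / (of_nat ?n * w $ i))) *s affine_point i w)) (at w)"
  proof (rule has_derivative_vecI)
    fix j
    show "((\<lambda>w'. G w' $ j) has_derivative
      (\<lambda>x. (s *s (x - x $ i *s axis i 1) + (s * (x $ i / (of_nat ?n * w $ i))) *s affine_point i w) $ j)) (at w)"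
      unfolding G_def vector_smult_component
      by (rule has_derivative_eq_rhs[OF has_derivative_mult[OF \<sigma>' affine_point_deriv]])
         (auto simp: \<sigma>0 fun_eq_iff algebra_simps)
  qed
  have "isCont G w" using G' by (rule has_derivative_continuous)
  moreover have Gw: "G w = v0" by (simp add: G_def \<sigma>0 s)
  ultimately have "\<forall>\<^sub>F w' in at w. G w' \<in> V"
    using V(2) v0(1) by (metis continuous_at_open continuous_within topological_tendstoD)
  moreover have "isCont (\<lambda>w'. w' $ i) w" by (intro continuous_intros)
  then have "\<forall>\<^sub>F w' in at w. w' $ i \<noteq> 0"
    using t by (metis continuous_within tendsto_imp_eventually_ne)
  ultimately have ev: "\<forall>\<^sub>F w' in at w. G w' = local_rep (chart_domain i, chart_coord i) d blowdown w'"
  proof eventually_elim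
    case (elim w')
    then have "blowdown (total_point i w') = mu_class (G w')"
      unfolding G_def by (intro blowdown_total_point \<sigma>_pow)
    then show ?case using elim V
      by (simp add: local_rep_def chart_point_total)
  qed
  have lw: "snd d (blowdown (total_point i w)) = s *s affine_point i w"
    using V v0 s by simp
  show ?thesis
  proof (rule that[OF s(1) lw], rule has_derivative_transform_eventually[OF G' ev])
    show "G w = local_rep (chart_domain i, chart_coord i) d blowdown w"
      using lw by (simp add: local_rep_def chart_point_total Gw s(2))
  qed simp
qed

lemma ceh_chart_pullback:
  assumes a: "a > 0"
  shows "metric_pullback_on (total_space - zero_section) total_atlas quotient_atlas blowdown
    (ceh_chart a) (\<lambda>c. ceh_standard a :: complex ^ 'n::finite \<Rightarrow> _)"
  unfolding metric_pullback_on_def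
proof (intro ballI impI allI)
  fix c d and p :: "(complex ^ 'n) \<times> (complex ^ 'n) set" and x y
  assume c: "c \<in> total_atlas" and d: "d \<in> quotient_atlas"
    and p: "p \<in> (total_space - zero_section) \<inter> fst c" and q: "blowdown p \<in> fst d"
  from c obtain i where i: "c = (chart_domain i, chart_coord i)" by (auto simp: total_atlas_def)
  define w where "w = chart_coord i p"
  have pw: "p = total_point i w" using p by (simp add: i w_def total_point_chart)
  have "w $ i \<noteq> 0"
  proof
    assume "w $ i = 0"
    then have "fst p = 0" by (simp add: pw total_point_def vec_eq_iff)
    then show False using p by (auto simp: zero_section_def)
  qed
  note t = this
  obtain s where s: "s ^ CARD('n) = w $ i" "snd d (blowdown p) = s *s affine_point i w"
    and der: "(local_rep c d blowdown has_derivative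
      (\<lambda>x. s *s (x - x $ i *s axis i 1) + (s * (x $ i / (of_nat CARD('n) * w $ i))) *s affine_point i w)) (at w)"
    using blowdown_local_rep[OF d t, folded pw i] q by blast
  have "local_diff c d blowdown p = (\<lambda>x. s *s (x - x $ i *s axis i 1) + (s * (x $ i / (of_nat CARD('n) * w $ i))) *s affine_point i w)"
    unfolding local_diff_def using der by (simp add: i flip: w_def frechet_derivative_at)
  then show "ceh_chart a c (snd c p) x y =
      ceh_standard a (snd d (blowdown p)) (local_diff c d blowdown p x) (local_diff c d blowdown p y)"
    using ceh_standard_pullback[OF a s(1) \<open>w $ i \<noteq> 0\<close>] by (simp add: i s(2) flip: w_def)
qed

subsection \<open>Invariance under coordinate changes\<close>

lemma total_transition:
  fixes w :: "complex ^ 'n::finite"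
  assumes "affine_point i w $ k \<noteq> 0"
  shows "(local_rep (chart_domain i, chart_coord i) (chart_domain k, chart_coord k) id has_derivative
     (\<lambda>x. \<chi> j. if j = k
       then x $ i * affine_point i w $ k ^ CARD('n) +
            w $ i * (of_nat CARD('n) * affine_point i w $ k ^ (CARD('n) - 1) * (x - x $ i *s axis i 1) $ k)
       else (x - x $ i *s axis i 1) $ j / affine_point i w $ k -
            affine_point i w $ j * (x - x $ i *s axis i 1) $ k / (affine_point i w $ k)\<^sup>2)) (at w)"
    (is "(_ has_derivative ?L) _")
proof -
  define T where "T w' = (\<chi> j. if j = k then w' $ i * affine_point i w' $ k ^ CARD('n)
          else affine_point i w' $ j / affine_point i w' $ k)" for w' :: "complex ^ 'n"
  have "(T has_derivative ?L) (at w)"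
  proof (rule has_derivative_vecI)
    fix j
    show "((\<lambda>w'. T w' $ j) has_derivative (\<lambda>x. ?L x $ j)) (at w)"
    proof (cases "j = k")
      case True
      from has_derivative_mult[OF nth_deriv[of i w] has_derivative_power[OF affine_point_deriv[of i k w], of "CARD('n)"]]
      show ?thesis unfolding T_def using True
        by (simp add: algebra_simps cong: if_cong)
    next
      case False
      from has_derivative_divide[OF affine_point_deriv[of i j w] affine_point_deriv[of i k w] assms]
      have "((\<lambda>w. affine_point i w $ j / affine_point i w $ k) has_derivative (\<lambda>x. ?L x $ j)) (at w)"
        by (rule has_derivative_eq_rhs) (use False assms in \<open>auto simp: fun_eq_iff field_simps power2_eq_square\<close>)
      then show ?thesis unfolding T_def using False by simp
    qed
  qed
  moreover have "\<forall>\<^sub>F w' in at w. T w' = local_rep (chart_domain i, chart_coord i) (chart_domain k, chart_coord k) id w'"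
  proof -
    have "isCont (\<lambda>w'. affine_point i w' $ k) w" by (rule has_derivative_continuous[OF affine_point_deriv])
    then have "\<forall>\<^sub>F w' in at w. affine_point i w' $ k \<noteq> 0"
      using assms by (metis continuous_within tendsto_imp_eventually_ne)
    then show ?thesis
      by eventually_elim (simp add: T_def local_rep_def chart_point_total chart_total_point)
  qed
  moreover have "T w = local_rep (chart_domain i, chart_coord i) (chart_domain k, chart_coord k) id w"
    using assms by (simp add: T_def local_rep_def chart_point_total chart_total_point)
  ultimately show ?thesis
    using has_derivative_transform_eventually[of T ?L w UNIV] by auto
qed

lemma ceh_hermitian_transition:
  fixes w :: "complex ^ 'n::finite"
  assumes nz: "affine_point i w $ k \<noteq> 0"
  defines "w' \<equiv> chart_coord k (total_point i w)"
    and "L \<equiv> \<lambda>x. \<chi> j. if j = k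
       then x $ i * affine_point i w $ k ^ CARD('n) +
            w $ i * (of_nat CARD('n) * affine_point i w $ k ^ (CARD('n) - 1) * (x - x $ i *s axis i 1) $ k)
       else (x - x $ i *s axis i 1) $ j / affine_point i w $ k -
            affine_point i w $ j * (x - x $ i *s axis i 1) $ k / (affine_point i w $ k)\<^sup>2"
  shows "ceh_hermitian a k w' (L x) (L y) = ceh_hermitian a i w x y"
proof -
  let ?n = "CARD('n)"
  define v where "v = affine_point i w"
  define b where "b x = x - x $ i *s axis i 1" for x :: "complex ^ 'n"
  define h where "h = (norm v)\<^sup>2"
  have vk: "v $ k \<noteq> 0" using nz by (simp add: v_def)
  have v0: "v \<noteq> 0" by (simp add: v_def)
  have h0: "h > 0" using v0 by (simp add: h_def)
  have hv: "herm v v = of_real h" unfolding h_def by (rule herm_self)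
  have w': "w' = (\<chi> j. if j = k then w $ i * v $ k ^ ?n else v $ j / v $ k)"
    unfolding w'_def v_def by (rule chart_total_point[OF nz])
  have aff: "affine_point k w' = (1 / v $ k) *s v"
    using vk by (auto simp: vec_eq_iff w' affine_point_def)
  have bL: "L x - L x $ k *s axis k 1 = (1 / v $ k) *s b x + (- (b x $ k) / (v $ k)\<^sup>2) *s v" for x
    using vk unfolding L_def v_def[symmetric] b_def[symmetric]
    by (auto simp: vec_eq_iff axis_def field_simps power2_eq_square)
  have fs: "fs (affine_point k w') (L x - L x $ k *s axis k 1) (L y - L y $ k *s axis k 1) = fs v (b x) (b y)" for x y
    unfolding aff bL using v0 vk by (intro fs_scale) auto
  have hk: "herm (affine_point k w') (affine_point k w') = of_real (h / (norm (v $ k))\<^sup>2)"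
    unfolding aff herm_simps hv of_real_divide complex_norm_square by simp
  have pow: "v $ k ^ ?n = v $ k ^ (?n - 1) * v $ k"
    by (metis One_nat_def Suc_pred power_Suc2 zero_less_card_finite)
  have ff: "fibre_form k w' (L x) = v $ k ^ ?n * fibre_form i w x" for x
  proof -
    have "herm (L x - L x $ k *s axis k 1) (affine_point k w') / herm (affine_point k w') (affine_point k w')
        = herm (b x) v / of_real h - b x $ k / v $ k"
      unfolding aff bL herm_simps hv using vk h0 by (simp add: field_simps power2_eq_square)
    moreover have "L x $ k = x $ i * v $ k ^ ?n + w $ i * (of_nat ?n * v $ k ^ (?n - 1) * b x $ k)"
      by (simp add: L_def v_def b_def)
    moreover have "w' $ k = w $ i * v $ k ^ ?n" by (simp add: w')
    moreover have "(X * (K * V) + t * (N * K * B)) / N + t * (K * V) * (C - B / V) = K * V * (X / N + t * C)"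
      if "N \<noteq> 0" "V \<noteq> 0" for X K V t N B C :: complex
      using that by (simp add: field_simps)
    ultimately show ?thesis
      unfolding fibre_form_def v_def[symmetric] b_def[symmetric] hv times_divide_eq_right[symmetric] pow
      using vk by simp
  qed
  have rad: "ceh_radius a k w' = ceh_radius a i w"
  proof -
    have "(norm (affine_point k w'))\<^sup>2 = h / (norm (v $ k))\<^sup>2"
      using hk unfolding herm_self of_real_eq_iff .
    moreover have "(norm (w' $ k))\<^sup>2 = (norm (w $ i))\<^sup>2 * ((norm (v $ k))\<^sup>2) ^ ?n"
      by (simp add: w' norm_mult norm_power power_mult_distrib power_mult[symmetric] mult.commute)
    ultimately show ?thesis
      unfolding ceh_radius_eq using vk by (simp add: power_divide h_def v_def)
  qed
  have "herm (affine_point k w') (affine_point k w') ^ ?n * fibre_form k w' (L x) * cnj (fibre_form k w' (L y))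
     = of_real h ^ ?n * fibre_form i w x * cnj (fibre_form i w y)"
  proof -
    have "herm (affine_point k w') (affine_point k w') * (v $ k * cnj (v $ k)) = of_real h"
      unfolding hk of_real_divide complex_norm_square using vk by simp
    then have "of_real h ^ ?n = herm (affine_point k w') (affine_point k w') ^ ?n * (v $ k ^ ?n * cnj (v $ k) ^ ?n)"
      by (metis power_mult_distrib)
    then show ?thesis unfolding ff by (simp add: mult.assoc mult.left_commute)
  qed
  then show ?thesis
    unfolding ceh_hermitian_def rad fs unfolding v_def[symmetric] b_def[symmetric] hv
    by (simp add: mult.assoc)
qed

lemma ceh_chart_compatible: "metric_pullback_on UNIV total_atlas total_atlas id (ceh_chart a) (ceh_chart a :: (_, 'n::finite) metric)"
  unfolding metric_pullback_on_def
proof (intro ballI impI allI)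
  fix c d and p :: "(complex ^ 'n) \<times> (complex ^ 'n) set" and x y
  assume c: "c \<in> total_atlas" and d: "d \<in> total_atlas" and p: "p \<in> UNIV \<inter> fst c" "id p \<in> fst d"
  from c d obtain i k where ik: "c = (chart_domain i, chart_coord i)" "d = (chart_domain k, chart_coord k)"
    by (auto simp: total_atlas_def)
  define w where "w = chart_coord i p"
  have pw: "p = total_point i w" using p by (simp add: ik w_def total_point_chart)
  have nz: "affine_point i w $ k \<noteq> 0" using p by (simp add: ik pw total_point_in)
  show "ceh_chart a c (snd c p) x y = ceh_chart a d (snd d (id p)) (local_diff c d id p x) (local_diff c d id p y)"
    unfolding local_diff_def ik ceh_chart_eq snd_conv w_def[symmetric] id_apply
      frechet_derivative_at[OF total_transition[OF nz], symmetric]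
    unfolding pw ceh_hermitian_transition[OF nz] ..
qed

subsection \<open>Positivity\<close>

lemma ceh_hermitian_real_linear:
  "ceh_hermitian a i w (x + x') y = ceh_hermitian a i w x y + ceh_hermitian a i w x' y"
  "ceh_hermitian a i w (r *\<^sub>R x) y = of_real r * ceh_hermitian a i w x y"
proof -
  have b: "(x + x') - (x + x') $ i *s axis i 1 = (x - x $ i *s axis i 1) + (x' - x' $ i *s axis i 1)"
    "(r *\<^sub>R x) - (r *\<^sub>R x) $ i *s axis i 1 = of_real r *s (x - x $ i *s axis i 1)"
    by (simp_all add: vec_eq_iff algebra_simps scaleR_conv_of_real[where 'a = complex])
  have fs: "fs v (x + x') y = fs v x y + fs v x' y" "fs v (c *s x) y = c * fs v x y" for v x x' y c
    by (simp_all add: fs_def herm_simps add_divide_distrib algebra_simps)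
  have fib: "fibre_form i w (x + x') = fibre_form i w x + fibre_form i w x'"
    "fibre_form i w (r *\<^sub>R x) = of_real r * fibre_form i w x"
    unfolding fibre_form_def b herm_simps(1,3)
    by (simp_all add: add_divide_distrib algebra_simps scaleR_conv_of_real[where 'a = complex])
  show
    "ceh_hermitian a i w (x + x') y = ceh_hermitian a i w x y + ceh_hermitian a i w x' y"
    "ceh_hermitian a i w (r *\<^sub>R x) y = of_real r * ceh_hermitian a i w x y"
    unfolding ceh_hermitian_def b fs fib by (simp_all add: algebra_simps)
qed

lemma ceh_hermitian_cnj: "cnj (ceh_hermitian a i w x y) = ceh_hermitian a i w y x"
  by (simp add: ceh_hermitian_def fs_def herm_cnj mult.commute mult.left_commute)

lemma ceh_hermitian_sym: "Re (ceh_hermitian a i w x y) = Re (ceh_hermitian a i w y x)"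
  by (metis ceh_hermitian_cnj complex_cnj(1) cnj.sel(1))

lemma ceh_hermitian_pos:
  fixes w :: "complex ^ 'n::finite"
  assumes a: "a > 0" and x: "x \<noteq> 0"
  shows "Re (ceh_hermitian a i w x x) > 0"
proof -
  let ?n = "CARD('n)"
  define b where "b = x - x $ i *s axis i 1"
  define v where "v = affine_point i w"
  define v' where "v' = v - axis i 1"
  define h where "h = (norm v)\<^sup>2"
  have R: "ceh_radius a i w > 0" using a by (rule ceh_radius_pos)
  have hv: "herm v v = of_real h" unfolding h_def by (rule herm_self)
  have h0: "h > 0" by (simp add: h_def v_def)
  have axis: "herm y (axis i 1) = y $ i" for y :: "complex ^ 'n"
  proof -
    have "herm y (axis i 1) = (\<Sum>j\<in>UNIV. if j = i then y $ j else 0)"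
      unfolding herm_def axis_def by (intro sum.cong refl) simp
    then show ?thesis by simp
  qed
  have bi: "b $ i = 0" and vi: "v' $ i = 0" by (simp_all add: b_def v'_def v_def)
  have bv: "herm b v = herm b v'" by (simp add: v'_def herm_simps axis bi)
  have "herm v v = herm v' v' + 1"
  proof -
    have "v = v' + axis i 1" by (simp add: v'_def)
    moreover have "herm (axis i 1) v' = 0" by (metis axis complex_cnj_zero herm_cnj vi)
    ultimately show ?thesis by (simp add: herm_simps axis vi)
  qed
  then have "complex_of_real h = of_real ((norm v')\<^sup>2 + 1)" by (simp add: h_def herm_self)
  then have hv': "h = (norm v')\<^sup>2 + 1" unfolding of_real_eq_iff .
  define F where "F = (norm b)\<^sup>2 / h - (norm (herm b v))\<^sup>2 / h\<^sup>2"
  have fs: "fs v b b = of_real F"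
  proof -
    have "herm b v * herm v b = of_real ((norm (herm b v))\<^sup>2)"
      by (subst herm_cnj[of b v, symmetric]) (rule complex_norm_square[symmetric])
    then show ?thesis by (simp add: fs_def F_def hv herm_self[of b])
  qed
  have "norm (herm b v) \<le> norm b * norm v'" unfolding bv by (rule herm_cauchy_schwarz)
  then have cs: "(norm (herm b v))\<^sup>2 \<le> (norm b)\<^sup>2 * (h - 1)"
    unfolding hv' by (metis add_diff_cancel_right' norm_ge_zero power_mono power_mult_distrib)
  have F: "F \<ge> (norm b)\<^sup>2 / h\<^sup>2"
  proof -
    have "F = ((norm b)\<^sup>2 * h - (norm (herm b v))\<^sup>2) / h\<^sup>2"
      using h0 by (simp add: F_def field_simps power2_eq_square)
    then show ?thesis using cs h0 by (simp add: divide_right_mono algebra_simps)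
  qed
  define \<theta> where "\<theta> = fibre_form i w x"
  have eq: "Re (ceh_hermitian a i w x x) = ceh_radius a i w powr (1 / ?n) * F +
      ceh_radius a i w powr (1 / ?n - 1) * h ^ ?n * (norm \<theta>)\<^sup>2"
  proof -
    have "ceh_hermitian a i w x x = of_real (ceh_radius a i w powr (1 / ?n) * F +
      ceh_radius a i w powr (1 / ?n - 1) * h ^ ?n * (norm \<theta>)\<^sup>2)"
      unfolding ceh_hermitian_def b_def[symmetric] v_def[symmetric] hv fs \<theta>_def[symmetric]
        of_real_add of_real_mult complex_norm_square
      by (simp add: mult.assoc)
    then show ?thesis by simp
  qed
  have F0: "F \<ge> 0" using F h0 by (meson divide_nonneg_nonneg order_trans zero_le_power2)
  show ?thesis
  proof (cases "b = 0")
    case True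
    have "x $ i \<noteq> 0" using x True by (auto simp: b_def)
    then have "\<theta> \<noteq> 0" unfolding \<theta>_def fibre_form_def b_def[symmetric] True by (simp add: herm_def)
    then show ?thesis unfolding eq using R h0 F0 by (intro add_nonneg_pos) auto
  next
    case False
    then have "F > 0" using F h0 by (smt (verit) divide_pos_pos zero_less_power zero_less_norm_iff)
    then show ?thesis unfolding eq using R h0 by (intro add_pos_nonneg) auto
  qed
qed

lemma ceh_hermitian_bilinear: "bilinear (\<lambda>x y. Re (ceh_hermitian a i w x y))"
proof -
  have "linear (\<lambda>x. Re (ceh_hermitian a i w x y))" for y
    by (intro linearI) (simp_all add: ceh_hermitian_real_linear)
  moreover have "linear (\<lambda>y. Re (ceh_hermitian a i w x y))" for x
    by (subst ceh_hermitian_sym) (intro linearI; simp add: ceh_hermitian_real_linear)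
  ultimately show ?thesis by (simp add: bilinear_def)
qed

subsection \<open>Smoothness\<close>

inductive smooth_alg :: "('a::real_normed_vector \<Rightarrow> complex) \<Rightarrow> bool" where
  lin: "bounded_linear f \<Longrightarrow> smooth_alg f"
| const: "smooth_alg (\<lambda>x. c)"
| add: "smooth_alg f \<Longrightarrow> smooth_alg g \<Longrightarrow> smooth_alg (\<lambda>x. f x + g x)"
| mult: "smooth_alg f \<Longrightarrow> smooth_alg g \<Longrightarrow> smooth_alg (\<lambda>x. f x * g x)"
| cnj: "smooth_alg f \<Longrightarrow> smooth_alg (\<lambda>x. cnj (f x))"
| powr: "smooth_alg f \<Longrightarrow> (\<And>x. Re (f x) > 0) \<Longrightarrow> smooth_alg (\<lambda>x. of_real (Re (f x) powr r))"

lemma smooth_alg_deriv: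
  "smooth_alg f \<Longrightarrow> \<exists>f'. (\<forall>x. (f has_derivative f' x) (at x)) \<and> (\<forall>v. smooth_alg (\<lambda>x. f' x v))"
proof (induction rule: smooth_alg.induct)
  case (lin f)
  then show ?case
    by (intro exI[of _ "\<lambda>x. f"]) (auto simp: bounded_linear_imp_has_derivative smooth_alg.const)
next
  case (const c)
  show ?case by (intro exI[of _ "\<lambda>x v. 0"]) (auto intro: smooth_alg.const)
next
  case (add f g)
  then obtain f' g' where "\<forall>x. (f has_derivative f' x) (at x)" "\<forall>v. smooth_alg (\<lambda>x. f' x v)"
     "\<forall>x. (g has_derivative g' x) (at x)" "\<forall>v. smooth_alg (\<lambda>x. g' x v)" by blast
  then show ?case
    by (intro exI[of _ "\<lambda>x v. f' x v + g' x v"]) (auto intro: smooth_alg.intros has_derivative_add)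
next
  case (mult f g)
  then obtain f' g' where "\<forall>x. (f has_derivative f' x) (at x)" "\<forall>v. smooth_alg (\<lambda>x. f' x v)"
     "\<forall>x. (g has_derivative g' x) (at x)" "\<forall>v. smooth_alg (\<lambda>x. g' x v)" by blast
  then show ?case using mult.hyps
    by (intro exI[of _ "\<lambda>x v. f x * g' x v + f' x v * g x"] conjI allI has_derivative_mult smooth_alg.add smooth_alg.mult) auto
next
  case (cnj f)
  then obtain f' where "\<forall>x. (f has_derivative f' x) (at x)" "\<forall>v. smooth_alg (\<lambda>x. f' x v)" by blast
  then show ?case
    by (intro exI[of _ "\<lambda>x v. cnj (f' x v)"]) (auto intro: smooth_alg.intros has_derivative_cnj)
next
  case (powr f r)
  then obtain f' where f': "\<And>x. (f has_derivative f' x) (at x)" "\<And>v. smooth_alg (\<lambda>x. f' x v)" by blast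
  let ?D = "\<lambda>x v. of_real r * of_real (Re (f x) powr (r - 1)) * ((f' x v + cnj (f' x v)) * (1 / 2))"
  have "((\<lambda>x. complex_of_real (Re (f x) powr r)) has_derivative ?D x) (at x)" for x
  proof -
    have 1: "((\<lambda>x. Re (f x)) has_derivative (\<lambda>v. Re (f' x v))) (at x)"
      using f'(1) by (rule has_derivative_Re)
    have 2: "((\<lambda>t. t powr r) has_derivative (\<lambda>v. (r * Re (f x) powr (r - 1)) * v)) (at (Re (f x)))"
      using has_real_derivative_powr[OF powr.hyps(2)[of x], of r] unfolding has_field_derivative_def .
    show ?thesis
      by (rule has_derivative_eq_rhs[OF has_derivative_of_real[OF has_derivative_compose[OF 1 2]]])
         (auto simp: fun_eq_iff complex_eq_iff)
  qed
  moreover have "smooth_alg (\<lambda>x. ?D x v)" for v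
    using powr.hyps f'(2) by (intro smooth_alg.mult smooth_alg.add smooth_alg.cnj smooth_alg.const smooth_alg.powr)
  ultimately show ?case by (intro exI[of _ ?D]) auto
qed

lemma smooth_alg_smooth_on: "smooth_alg f \<Longrightarrow> smooth_on UNIV (\<lambda>x. Re (f x))"
proof (coinduction arbitrary: f rule: smooth_on.coinduct)
  case (smooth_on f)
  then obtain f' where f': "\<And>x. (f has_derivative f' x) (at x)" "\<And>v. smooth_alg (\<lambda>x. f' x v)"
    using smooth_alg_deriv by metis
  have D: "((\<lambda>x. Re (f x)) has_derivative (\<lambda>v. Re (f' x v))) (at x)" for x
    using f'(1) by (rule has_derivative_Re)
  then have "frechet_derivative (\<lambda>x. Re (f x)) (at x) = (\<lambda>v. Re (f' x v))" for x
    by (metis frechet_derivative_at)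
  with D f'(2) show ?case by (auto simp: differentiable_def)
qed

lemma smooth_alg_sum: "(\<And>j. j \<in> J \<Longrightarrow> smooth_alg (\<lambda>x. f j x)) \<Longrightarrow> smooth_alg (\<lambda>x. \<Sum>j\<in>J. f j x)"
  by (induction J rule: infinite_finite_induct) (auto intro: smooth_alg.intros)

lemma smooth_alg_power: "smooth_alg f \<Longrightarrow> smooth_alg (\<lambda>x. f x ^ m)"
  by (induction m) (auto intro: smooth_alg.intros)

lemma smooth_alg_diff: "smooth_alg f \<Longrightarrow> smooth_alg g \<Longrightarrow> smooth_alg (\<lambda>x. f x - g x)"
  using smooth_alg.add[OF _ smooth_alg.mult[OF smooth_alg.const[of "-1"]]] by fastforce

lemma ceh_hermitian_smooth:
  fixes x y :: "complex ^ 'n::finite"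
  assumes a: "a > 0"
  shows "smooth_alg (\<lambda>w. ceh_hermitian a i w x y)"
proof -
  have nth: "smooth_alg (\<lambda>w :: complex ^ 'n. w $ j)" for j
    by (intro smooth_alg.lin bounded_linear_vec_nth)
  have aff: "smooth_alg (\<lambda>w :: complex ^ 'n. affine_point i w $ j)" for j
    using nth smooth_alg.const by (cases "j = i") (auto simp: affine_point_def)
  have herm: "smooth_alg (\<lambda>w. herm (f w) (g w))"
    if "\<And>j. smooth_alg (\<lambda>w. f w $ j)" "\<And>j. smooth_alg (\<lambda>w. g w $ j)"
    for f g :: "complex ^ 'n \<Rightarrow> complex ^ 'n"
    unfolding herm_def using that by (intro smooth_alg_sum smooth_alg.mult smooth_alg.cnj)
  let ?h = "\<lambda>w. herm (affine_point i w) (affine_point i w)"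
  have h: "smooth_alg ?h" by (intro herm aff)
  have h_pos: "Re (?h w) > 0" for w :: "complex ^ 'n" by (simp add: herm_self)
  have hinv: "1 / ?h w = of_real (Re (?h w) powr (-1))" for w :: "complex ^ 'n"
    by (simp add: herm_self powr_minus_divide)
  have inv: "smooth_alg (\<lambda>w. 1 / ?h w)"
    unfolding hinv by (intro smooth_alg.powr h h_pos)
  define \<rho> where "\<rho> w = of_real (a ^ CARD('n)) + w $ i * cnj (w $ i) * ?h w ^ CARD('n)" for w
  have \<rho>: "smooth_alg \<rho>" unfolding \<rho>_def using nth h
    by (intro smooth_alg.add smooth_alg.mult smooth_alg.cnj smooth_alg_power smooth_alg.const)
  have \<rho>_eq: "ceh_radius a i w = Re (\<rho> w)" for w by (simp add: ceh_radius_def \<rho>_def)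
  have \<rho>_pos: "Re (\<rho> w) > 0" for w using ceh_radius_pos[OF a, of i w] by (simp add: \<rho>_eq)
  have fib: "smooth_alg (\<lambda>w. fibre_form i w x)" for x
  proof -
    have "fibre_form i w x = x $ i / of_nat CARD('n) + w $ i * herm (x - x $ i *s axis i 1) (affine_point i w) * (1 / ?h w)" for w
      by (simp add: fibre_form_def)
    then show ?thesis using nth inv
      by (simp only:) (intro smooth_alg.add smooth_alg.mult smooth_alg.const herm aff)
  qed
  have fs: "smooth_alg (\<lambda>w. fs (affine_point i w) x y)" for x y
  proof -
    have "fs (affine_point i w) x y = herm x y * (1 / ?h w) - herm x (affine_point i w) * herm (affine_point i w) y * (1 / ?h w)\<^sup>2" for w
      by (simp add: fs_def power_divide)
    then show ?thesis using inv
      by (simp only:) (intro smooth_alg_diff smooth_alg.mult smooth_alg_power smooth_alg.const herm aff)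
  qed
  show ?thesis unfolding ceh_hermitian_def \<rho>_eq
    by (intro smooth_alg.add smooth_alg.mult smooth_alg.cnj smooth_alg_power smooth_alg.powr \<rho> \<rho>_pos fs fib h)
qed

lemma ceh_metric_exists:
  assumes "a > 0"
  shows "ceh_metric a (ceh_chart a :: ((complex ^ 'n::finite) \<times> (complex ^ 'n) set, 'n) metric)"
proof -
  have "ceh_chart a (chart_domain i, chart_coord i) w = (\<lambda>x y. Re (ceh_hermitian a i w x y))" for i :: 'n and w
    by (intro ext) simp
  then show ?thesis
    unfolding ceh_metric_def riemannian_metric_def
    using assms ceh_chart_pullback ceh_chart_compatible ceh_hermitian_bilinear ceh_hermitian_pos
      smooth_alg_smooth_on[OF ceh_hermitian_smooth[OF assms]] ceh_hermitian_sym
    by (auto simp: total_atlas_def chart_image_total)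
qed

subsection \<open>The atlases\<close>

lemma holomorphic_fun_onI:
  assumes "\<And>x. x \<in> S \<Longrightarrow> (f has_derivative L x) (at x)" "\<And>x c v. x \<in> S \<Longrightarrow> L x (c *s v) = c * L x v"
  shows "holomorphic_fun_on S f"
  using assms unfolding holomorphic_fun_on_def by blast

lemma complex_atlas_total: "complex_atlas (total_atlas :: (_, complex ^ 'n::finite) chart set)"
proof -
  have "inj_on (chart_coord i) (chart_domain i)" for i :: 'n
    by (metis inj_onI total_point_chart)
  moreover have img: "chart_coord i ` (chart_domain i \<inter> chart_domain k) = {w. affine_point i w $ k \<noteq> 0}" for i k :: 'n
  proof (intro set_eqI iffI)
    fix w assume "w \<in> {w. affine_point i w $ k \<noteq> 0}"
    then have "total_point i w \<in> chart_domain i \<inter> chart_domain k" by (simp add: total_point_in)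
    then show "w \<in> chart_coord i ` (chart_domain i \<inter> chart_domain k)"
      by (rule rev_image_eqI) simp
  qed (auto simp: total_point_in[symmetric] total_point_chart)
  moreover have "open {w. affine_point i w $ k \<noteq> 0}" for i k :: 'n
  proof -
    have "continuous_on UNIV (\<lambda>w. affine_point i w $ k)"
      by (intro continuous_at_imp_continuous_on ballI has_derivative_continuous[OF affine_point_deriv])
    then show ?thesis by (intro open_Collect_neq) auto
  qed
  moreover have "holomorphic_fun_on {w. affine_point i w $ k \<noteq> 0}
    (\<lambda>x. local_rep (chart_domain i, chart_coord i) (chart_domain k, chart_coord k) id x $ j)" for i j k :: 'n
    by (rule holomorphic_fun_onI[OF bounded_linear.has_derivative[OF bounded_linear_vec_nth total_transition]])
       (auto simp: field_simps)
  ultimately show ?thesis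
    by (auto simp: complex_atlas_def total_atlas_def chart_image_total)
qed

lemma norm_smult: "norm (c *s (x :: complex ^ 'n::finite)) = norm c * norm x"
proof -
  have "complex_of_real ((norm (c *s x))\<^sup>2) = of_real ((norm c * norm x)\<^sup>2)"
    unfolding herm_self[symmetric] herm_simps power_mult_distrib of_real_mult complex_norm_square by simp
  then show ?thesis unfolding of_real_eq_iff by (simp add: power2_eq_iff_nonneg)
qed

lemma finite_roots_of_unity: "finite {c :: complex. c ^ CARD('n::finite) = 1}"
  using finite_roots_unity[of "CARD('n)"] by (simp add: Suc_leI)

lemma quotient_chart_point:
  "inj_on mu_class V \<Longrightarrow> x \<in> V \<Longrightarrow> chart_point (mu_class ` V, inv_into V mu_class) x = mu_class x"
  unfolding chart_point_def fst_conv snd_conv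
  by (rule inv_into_f_eq) (auto simp only: intro: inj_on_inv_into inv_into_f_f)

lemma quotient_chart_image:
  "inj_on mu_class V \<Longrightarrow> chart_image (mu_class ` V, inv_into V mu_class) = V"
  unfolding chart_image_def fst_conv snd_conv by (rule inv_into_image_cancel) auto

lemma quotient_atlas_covers: "\<Union> (fst ` quotient_atlas) = (punctured_quotient :: (complex ^ 'n::finite) set set)"
proof -
  have main: "\<exists>V. open V \<and> 0 \<notin> V \<and> inj_on mu_class V \<and> x \<in> V" if x: "x \<noteq> 0" for x :: "complex ^ 'n"
  proof -
    let ?D = "insert 1 ((\<lambda>c. norm (c - 1)) ` ({c :: complex. c ^ CARD('n) = 1} - {1}))"
    define \<delta> where "\<delta> = Min ?D"
    have fin: "finite ?D" using finite_roots_of_unity by blast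
    have "\<delta> > 0" unfolding \<delta>_def using fin by (subst Min_gr_iff) auto
    have \<delta>: "\<delta> \<le> norm (c - 1)" if "c ^ CARD('n) = 1" "c \<noteq> 1" for c :: complex
      unfolding \<delta>_def using fin that by (intro Min_le) auto
    define r where "r = \<delta> * norm x / (2 + \<delta>)"
    have r: "r > 0" "r < norm x" "\<delta> * (norm x - r) = 2 * r"
      using x \<open>\<delta> > 0\<close> by (auto simp: r_def field_simps)
    have "inj_on mu_class (ball x r)"
    proof (rule inj_onI, rule ccontr)
      fix y y' assume y: "y \<in> ball x r" "y' \<in> ball x r" "mu_class y = mu_class y'" "y \<noteq> y'"
      then obtain c where c: "c ^ CARD('n) = 1" "y' = c *s y" by (auto simp: mu_class_eq_iff)
      with y have "c \<noteq> 1" by auto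
      have "\<delta> * (norm x - r) < \<delta> * norm y"
        using y(1) norm_triangle_ineq2[of x y] \<open>\<delta> > 0\<close> by (auto simp: dist_norm)
      also have "\<dots> \<le> norm (c - 1) * norm y"
        using \<delta>[OF c(1) \<open>c \<noteq> 1\<close>] by (simp add: mult_right_mono)
      also have "\<dots> = dist y' y"
        unfolding norm_smult[symmetric] dist_norm c(2) by (simp add: vec_eq_iff algebra_simps vector_sub_rdistrib)
      also have "\<dots> < 2 * r" using y(1,2) dist_triangle_half_r[of x y' "2 * r" y] by (simp add: dist_commute)
      finally show False using r(3) by simp
    qed
    then show ?thesis using r(1,2) by (intro exI[of _ "ball x r"]) auto
  qed
  have Q: "q \<in> punctured_quotient \<longleftrightarrow> (\<exists>x. x \<noteq> 0 \<and> q = mu_class x)" for q :: "(complex ^ 'n) set"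
    by (auto simp only: punctured_quotient_def quotient_def mu_class_def)
  have A: "q \<in> \<Union> (fst ` quotient_atlas) \<longleftrightarrow>
      (\<exists>V x. open V \<and> 0 \<notin> V \<and> inj_on mu_class V \<and> x \<in> V \<and> q = mu_class x)" for q :: "(complex ^ 'n) set"
    unfolding quotient_atlas_def by auto
  show ?thesis
    unfolding set_eq_iff Q A using main by metis
qed

lemma complex_atlas_quotient: "complex_atlas (quotient_atlas :: (_, complex ^ 'n::finite) chart set)"
  unfolding complex_atlas_def
proof (intro conjI ballI allI)
  fix c :: "((complex ^ 'n) set, complex ^ 'n) chart" assume "c \<in> quotient_atlas"
  then obtain V where V: "c = (mu_class ` V, inv_into V mu_class)" "open V" "inj_on mu_class V" "0 \<notin> V"
    by (auto simp: quotient_atlas_def)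
  show "inj_on (snd c) (fst c)" by (simp add: V inj_on_inv_into)
  show "open (chart_image c)" using V by (simp add: quotient_chart_image)
  fix d :: "((complex ^ 'n) set, complex ^ 'n) chart" and j assume "d \<in> quotient_atlas"
  then obtain W where W: "d = (mu_class ` W, inv_into W mu_class)" "open W" "inj_on mu_class W"
    by (auto simp: quotient_atlas_def)
  let ?S = "snd c ` (fst c \<inter> fst d)"
  have S: "x \<in> ?S \<longleftrightarrow> x \<in> V \<and> (\<exists>e. e ^ CARD('n) = 1 \<and> e *s x \<in> W)" for x
  proof -
    have "x \<in> ?S \<longleftrightarrow> x \<in> V \<and> mu_class x \<in> mu_class ` W"
    proof
      assume "x \<in> ?S"
      then obtain v where "v \<in> V" "mu_class v \<in> mu_class ` W" "x = inv_into V mu_class (mu_class v)"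
        by (auto simp only: V(1) W(1) fst_conv snd_conv)
      then show "x \<in> V \<and> mu_class x \<in> mu_class ` W" by (simp only: inv_into_f_f[OF V(3)])
    next
      assume "x \<in> V \<and> mu_class x \<in> mu_class ` W"
      then show "x \<in> ?S"
        by (intro image_eqI[of _ _ "mu_class x"]) (simp_all only: V(1) W(1) fst_conv snd_conv inv_into_f_f[OF V(3)] Int_iff imageI)
    qed
    also have "mu_class x \<in> mu_class ` W \<longleftrightarrow> (\<exists>e. e ^ CARD('n) = 1 \<and> e *s x \<in> W)"
      unfolding image_iff mu_class_eq_iff by metis
    finally show ?thesis .
  qed
  have lin: "bounded_linear (\<lambda>x :: complex ^ 'n. e *s x)" for e
    by (intro linear_conv_bounded_linear[THEN iffD1] linearI) (simp_all add: vec_eq_iff algebra_simps)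
  have nbhd: "\<forall>\<^sub>F y in nhds x. y \<in> V \<and> e *s y \<in> W" if "x \<in> V" "e *s x \<in> W" for x e
  proof (rule eventually_conj)
    show "\<forall>\<^sub>F y in nhds x. y \<in> V" using V(2) that(1) by (rule eventually_nhds_in_open)
    have "isCont (\<lambda>x. e *s x) x" using lin by (rule bounded_linear.isCont) simp
    then have "((\<lambda>x. e *s x) \<longlongrightarrow> e *s x) (nhds x)" by (simp add: isCont_def tendsto_nhds_iff)
    then show "\<forall>\<^sub>F y in nhds x. e *s y \<in> W" using W(2) that(2) by (rule topological_tendstoD)
  qed
  show "open ?S"
  proof (subst open_subopen, intro ballI)
    fix x assume "x \<in> ?S"
    then obtain e where e: "e ^ CARD('n) = 1" "x \<in> V" "e *s x \<in> W" by (auto simp only: S)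
    from nbhd[OF e(2,3)] obtain U where "open U" "x \<in> U" "\<forall>y\<in>U. y \<in> V \<and> e *s y \<in> W"
      unfolding eventually_nhds by blast
    then show "\<exists>T. open T \<and> x \<in> T \<and> T \<subseteq> ?S" using e(1) by (intro exI[of _ U]) (auto simp only: S subset_iff)
  qed
  show "holomorphic_fun_on ?S (\<lambda>x. local_rep c d id x $ j)"
    unfolding holomorphic_fun_on_def
  proof (rule ballI)
    fix x assume "x \<in> ?S"
    then obtain e where e: "e ^ CARD('n) = 1" "x \<in> V" "e *s x \<in> W" by (auto simp only: S)
    have eq: "local_rep c d id y = e *s y" if "y \<in> V" "e *s y \<in> W" for y
    proof -
      have "mu_class y = mu_class (e *s y)" using mu_class_scale[OF e(1)] by metis
      then show ?thesis using that V(3) W(3) unfolding local_rep_def V(1) W(1)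
        by (simp only: o_apply quotient_chart_point id_apply snd_conv inv_into_f_f)
    qed
    have "((\<lambda>y. (e *s y) $ j) has_derivative (\<lambda>v. (e *s v) $ j)) (at x)"
      by (intro bounded_linear_imp_has_derivative bounded_linear_compose[OF bounded_linear_vec_nth lin])
    moreover have "\<forall>\<^sub>F y in at x. (e *s y) $ j = local_rep c d id y $ j"
      unfolding eventually_at_filter using nbhd[OF e(2,3)] by eventually_elim (metis eq)
    moreover have "(e *s x) $ j = local_rep c d id x $ j" by (simp only: eq[OF e(2,3)])
    ultimately have "((\<lambda>y. local_rep c d id y $ j) has_derivative (\<lambda>v. (e *s v) $ j)) (at x)"
      by (rule has_derivative_transform_eventually) simp
    then show "\<exists>L. ((\<lambda>x. local_rep c d id x $ j) has_derivative L) (at x) \<and> (\<forall>c v. L (c *s v) = c * L v)"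
      by (intro exI[of _ "\<lambda>v. (e *s v) $ j"]) auto
  qed
qed

end

theory Submission
  imports Defs
begin

text \<open>In each chart of the total space the pulled back form is \<open>1/n\<close> times the coordinate volume form,
  so it extends holomorphically without zeros. In the same chart the metric is given by a Hermitian
  matrix \<open>H\<close> that satisfies the Kaehler condition, so the Levi-Civita connection is complex linear
  with \<open>H(\<nabla>\<^sub>X Y, Z) = (\<partial>\<^sub>X H)(Y, Z)\<close>, and \<open>\<nabla>\<^sub>X\<close> acts on the coordinate volume form by
  \<open>- \<partial>\<^sub>X log det H\<close>. Writing \<open>H(x, y) = \<langle>T x, T y\<rangle>\<close> gives \<open>det H = |det T|\<^sup>2 = 1/n\<^sup>2\<close>, which is constant.
  A metric as in \<open>ceh_metric\<close> agrees with the explicit one off the zero section, hence everywhere by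
  continuity.\<close>

section \<open>Determinants\<close>

lemma coord_volume_linear:
  fixes f :: "complex ^ 'n::finite \<Rightarrow> complex ^ 'n"
  assumes add: "\<And>x y. f (x + y) = f x + f y" and scale: "\<And>c x. f (c *s x) = c *s f x"
  shows "coord_volume (\<lambda>k. f (Y k)) = coord_volume (\<lambda>k. f (axis k 1)) * coord_volume Y"
proof -
  have zero: "f 0 = 0" using scale[of 0 0] by simp
  have sum: "f (sum g A) = (\<Sum>l\<in>A. f (g l))" if "finite A" for g and A :: "'n set"
    using that by induction (simp_all add: zero add)
  have expand: "f y $ j = (\<Sum>l\<in>UNIV. y $ l * f (axis l 1) $ j)" for y j
    by (subst basis_expansion[of y, symmetric]) (simp add: sum scale)
  have "(\<chi> k. f (Y k)) = (\<chi> k. Y k) ** (\<chi> k. f (axis k 1))"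
    using expand[of "Y _"] by (simp add: matrix_matrix_mult_def vec_eq_iff)
  then show ?thesis by (simp add: coord_volume_def det_mul)
qed

lemma coord_volume_axis: "coord_volume (\<lambda>k. axis k 1 :: complex ^ 'n::finite) = 1"
proof -
  have "(\<chi> k. axis k 1) = (mat 1 :: complex ^ 'n ^ 'n)"
    by (auto simp: vec_eq_iff axis_def mat_def)
  then show ?thesis by (simp add: coord_volume_def)
qed

lemma coord_volume_smult:
  "coord_volume (\<lambda>k. c *s Y k) = c ^ CARD('n) * coord_volume (Y :: 'n::finite \<Rightarrow> complex ^ 'n)"
  unfolding coord_volume_def using det_rows_mul[of "\<lambda>_. c" Y] by simp

lemma coord_volume_upd_add:
  "coord_volume (Y(k := x + y)) = coord_volume (Y(k := x)) + coord_volume (Y(k := y))"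
  using det_row_add[of k "\<lambda>_. x" "\<lambda>_. y" Y] by (simp add: coord_volume_def fun_upd_def)

lemma coord_volume_upd_smult:
  "coord_volume (Y(k := c *s x)) = c * coord_volume (Y(k := x))"
  using det_row_mul[of k c "\<lambda>_. x" Y] by (simp add: coord_volume_def fun_upd_def)

lemma coord_volume_upd_axis: "coord_volume ((\<lambda>k. axis k 1)(i := v)) = v $ i"
proof -
  have "coord_volume ((\<lambda>k. axis k 1)(i := v)) =
      det (\<chi> k. if k = i then \<Sum>l\<in>UNIV. v $ l *s row l (mat 1) else row k (mat 1 :: complex ^ 'a ^ 'a))"
    unfolding coord_volume_def
    by (rule arg_cong[of _ _ det]) (auto simp: vec_eq_iff row_def mat_def axis_def if_distrib cong: if_cong)
  then show ?thesis by (simp add: cramer_lemma_transpose)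
qed

lemma coord_volume_shear:
  fixes \<phi> :: "complex ^ 'n::finite \<Rightarrow> complex"
  assumes add: "\<And>x y. \<phi> (x + y) = \<phi> x + \<phi> y" and scale: "\<And>c x. \<phi> (c *s x) = c * \<phi> x"
    and v: "v $ i = 1"
  shows "coord_volume (\<lambda>k. Y k - Y k $ i *s axis i 1 + \<phi> (Y k) *s v) = \<phi> (axis i 1) * coord_volume Y"
proof -
  let ?A = "\<lambda>x. x - x $ i *s axis i 1 + x $ i *s v"
  let ?B = "\<lambda>x. x - x $ i *s axis i 1 + \<phi> x *s axis i 1"
  have AB: "x - x $ i *s axis i 1 + \<phi> x *s v = ?A (?B x)" for x
    by (simp add: vec_eq_iff axis_def)
  have "coord_volume (\<lambda>k. ?A (axis k 1)) = coord_volume ((\<lambda>k. axis k 1)(i := v))"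
    by (rule arg_cong[of _ _ coord_volume]) (auto simp: fun_eq_iff vec_eq_iff axis_def)
  then have A: "coord_volume (\<lambda>k. ?A (Y k)) = coord_volume Y" for Y
    by (subst coord_volume_linear) (simp_all add: coord_volume_upd_axis v vec_eq_iff algebra_simps)
  define p :: "complex ^ 'n" where "p = (\<chi> k. \<phi> (axis k 1))"
  have "coord_volume (\<lambda>k. ?B (axis k 1)) = det (transpose (\<chi> k. ((\<lambda>k. axis k 1)(i := p)) k))"
    unfolding coord_volume_def
    by (rule arg_cong[of _ _ det]) (auto simp: vec_eq_iff transpose_def p_def axis_def)
  also have "\<dots> = \<phi> (axis i 1)"
    unfolding det_transpose coord_volume_def[symmetric] coord_volume_upd_axis by (simp add: p_def)
  finally have B: "coord_volume (\<lambda>k. ?B (Y k)) = \<phi> (axis i 1) * coord_volume Y"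
    by (subst coord_volume_linear) (simp_all add: add scale vec_eq_iff algebra_simps)
  show ?thesis unfolding AB A B ..
qed

lemma has_derivative_coord_volume:
  fixes F :: "'v::real_normed_vector \<Rightarrow> 'n::finite \<Rightarrow> complex ^ 'n"
  assumes "\<And>k j. ((\<lambda>x. F x k $ j) has_derivative (\<lambda>v. F' v k $ j)) (at x)"
  shows "((\<lambda>x. coord_volume (F x)) has_derivative
    (\<lambda>v. \<Sum>k\<in>UNIV. coord_volume ((F x)(k := F' v k)))) (at x)"
proof -
  let ?P = "{p. p permutes (UNIV :: 'n set)}"
  have "((\<lambda>x. coord_volume (F x)) has_derivative
    (\<lambda>v. \<Sum>p\<in>?P. of_int (sign p) * (\<Sum>k\<in>UNIV. F' v k $ p k * (\<Prod>j\<in>UNIV - {k}. F x j $ p j)))) (at x)"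
    unfolding coord_volume_def det_def
    by (simp, intro has_derivative_sum has_derivative_mult_right has_derivative_prod assms)
  moreover have "(\<Sum>p\<in>?P. of_int (sign p) * (\<Sum>k\<in>UNIV. F' v k $ p k * (\<Prod>j\<in>UNIV - {k}. F x j $ p j)))
      = (\<Sum>k\<in>UNIV. coord_volume ((F x)(k := F' v k)))" for v
  proof -
    have "(\<Prod>j\<in>UNIV. ((F x)(k := F' v k)) j $ p j) = F' v k $ p k * (\<Prod>j\<in>UNIV - {k}. F x j $ p j)" for p k
      by (subst prod.remove[of _ k]) (auto intro!: prod.cong)
    then show ?thesis unfolding coord_volume_def det_def
      by (subst sum.swap) (simp add: sum_distrib_left)
  qed
  ultimately show ?thesis by simp
qed

section \<open>Kaehler metrics of constant determinant\<close>

definition sesquilinear :: "(complex ^ 'n::finite \<Rightarrow> complex ^ 'n \<Rightarrow> complex) \<Rightarrow> bool" where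
  "sesquilinear H \<longleftrightarrow>
     (\<forall>x x' y. H (x + x') y = H x y + H x' y) \<and> (\<forall>c x y. H (c *s x) y = c * H x y) \<and>
     (\<forall>x y y'. H x (y + y') = H x y + H x y') \<and> (\<forall>c x y. H x (c *s y) = cnj c * H x y)"

lemma scaleR_vec_smult: "r *\<^sub>R (x :: complex ^ 'n) = of_real r *s x"
  by (simp add: vec_eq_iff scaleR_conv_of_real[where 'a = complex])

lemma sesquilinear_represents:
  fixes H :: "complex ^ 'n::finite \<Rightarrow> complex ^ 'n \<Rightarrow> complex"
  assumes H: "sesquilinear H" and pos: "\<And>x. x \<noteq> 0 \<Longrightarrow> Re (H x x) > 0"
    and add: "\<And>x y. \<phi> (x + y) = \<phi> x + \<phi> y" and scale: "\<And>c x. \<phi> (c *s x) = cnj c * \<phi> x"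
  obtains V where "\<And>z. H V z = \<phi> z"
proof -
  have antilinear: "\<psi> z = (\<Sum>k\<in>UNIV. cnj (z $ k) * \<psi> (axis k 1))"
    if "\<And>x y. \<psi> (x + y) = \<psi> x + \<psi> y" "\<And>c x. \<psi> (c *s x) = cnj c * \<psi> x"
    for \<psi> :: "complex ^ 'n \<Rightarrow> complex" and z
  proof -
    have zero: "\<psi> 0 = 0" using that(2)[of 0 0] by simp
    have "\<psi> (sum g A) = (\<Sum>l\<in>A. \<psi> (g l))" if "finite A" for g and A :: "'n set"
      using that by induction (simp_all add: zero \<open>\<And>x y. \<psi> (x + y) = \<psi> x + \<psi> y\<close>)
    then show ?thesis
      by (subst basis_expansion[of z, symmetric]) (simp add: that(2))
  qed
  define f where "f x = (\<chi> k. H x (axis k 1))" for x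
  have H_f: "H x z = (\<Sum>k\<in>UNIV. cnj (z $ k) * f x $ k)" for x z
    using antilinear[of "H x" z] H by (simp add: f_def sesquilinear_def)
  have "linear f"
    using H by (intro linearI) (simp_all add: f_def vec_eq_iff sesquilinear_def scaleR_vec_smult)
  moreover have "x = 0" if "f x = 0" for x
    using pos[of x] H_f[of x x] that by auto
  ultimately have "surj f"
    by (intro linear_inj_imp_surj) (simp_all add: linear_injective_0)
  then obtain V where "f V = (\<chi> k. \<phi> (axis k 1))" by (metis surjD)
  then have "H V z = \<phi> z" for z
    using H_f[of V z] antilinear[of \<phi> z] add scale by simp
  then show ?thesis by (rule that)
qed

text \<open>\<open>D\<close> is the holomorphic derivative of the Hermitian metric \<open>H\<close>; its symmetry in the first two
  arguments is the Kaehler condition.\<close>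

lemma kaehler_christoffel:
  fixes H :: "complex ^ 'n::finite \<Rightarrow> complex ^ 'n \<Rightarrow> complex ^ 'n \<Rightarrow> complex"
  assumes deriv: "\<And>Y Z. ((\<lambda>w. H w Y Z) has_derivative (\<lambda>X. D X Y Z + cnj (D X Z Y))) (at x)"
    and sym: "\<And>X Y Z. D X Y Z = D Y X Z"
    and H: "sesquilinear (H x)" and pos: "\<And>Y. Y \<noteq> 0 \<Longrightarrow> Re (H x Y Y) > 0"
    and V: "\<And>Z. H x V Z = D X Y Z"
  shows "christoffel (\<lambda>w X Y. Re (H w X Y)) x X Y = V"
proof -
  have fd: "frechet_derivative (\<lambda>w. Re (H w Y Z)) (at x) = (\<lambda>X. Re (D X Y Z) + Re (D X Z Y))" for Y Z
    using frechet_derivative_at[OF has_derivative_Re[OF deriv[of Y Z]]] by simp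
  have koszul: "Re (D X Y Z) + Re (D X Z Y) + (Re (D Y X Z) + Re (D Y Z X)) - (Re (D Z X Y) + Re (D Z Y X))
      = 2 * Re (H x V Z)" for Z
    unfolding V sym[of Y X] sym[of Z X] sym[of Z Y] by simp
  show ?thesis
    unfolding christoffel_def fd koszul
  proof (rule the_equality)
    fix V' assume V': "\<forall>Z. 2 * Re (H x V' Z) = 2 * Re (H x V Z)"
    have "V' = (V' - V) + V" by simp
    then have "H x V' (V' - V) = H x (V' - V) (V' - V) + H x V (V' - V)"
      using H unfolding sesquilinear_def by metis
    with V'[rule_format, of "V' - V"] have "Re (H x (V' - V) (V' - V)) = 0" by simp
    then show "V' = V" using pos[of "V' - V"] by force
  qed simp
qed

lemma kaehler_volume_parallel:
  fixes H :: "complex ^ 'n::finite \<Rightarrow> complex ^ 'n \<Rightarrow> complex ^ 'n \<Rightarrow> complex"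
  assumes deriv: "\<And>Y Z. ((\<lambda>w. H w Y Z) has_derivative (\<lambda>X. D X Y Z + cnj (D X Z Y))) (at x)"
    and sym: "\<And>X Y Z. D X Y Z = D Y X Z"
    and D_scale: "\<And>c X Y Z. D (c *s X) Y Z = c * D X Y Z"
    and D_antilinear: "\<And>X Y Z Z'. D X Y (Z + Z') = D X Y Z + D X Y Z'" "\<And>c X Y Z. D X Y (c *s Z) = cnj c * D X Y Z"
    and H: "sesquilinear (H x)" and pos: "\<And>Y. Y \<noteq> 0 \<Longrightarrow> Re (H x Y Y) > 0"
    and det: "\<And>w Y. coord_volume (\<lambda>j. \<chi> k. H w (Y j) (axis k 1)) = C * coord_volume Y" and C: "C \<noteq> 0"
  shows "covariant_derivative (\<lambda>w X Y. Re (H w X Y)) (\<lambda>w Y. b * coord_volume Y) x X Y = 0"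
proof -
  define F where "F w j = (\<chi> k. H w (Y j) (axis k 1))" for w j
  \<comment> \<open>\<open>P\<close> and \<open>Q\<close> are the holomorphic and antiholomorphic parts of the derivative of \<open>det H\<close>; being complex linear and
    antilinear in \<open>X\<close>, they vanish separately.\<close>
  define P where "P X = (\<Sum>j\<in>UNIV. coord_volume ((F x)(j := \<chi> k. D X (Y j) (axis k 1))))" for X
  define Q where "Q X = (\<Sum>j\<in>UNIV. coord_volume ((F x)(j := \<chi> k. cnj (D X (axis k 1) (Y j)))))" for X
  have "((\<lambda>w. coord_volume (F w)) has_derivative (\<lambda>X. \<Sum>j\<in>UNIV.
      coord_volume ((F x)(j := (\<chi> k. D X (Y j) (axis k 1)) + (\<chi> k. cnj (D X (axis k 1) (Y j))))))) (at x)"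
    by (rule has_derivative_coord_volume) (simp add: F_def deriv)
  then have "((\<lambda>w. coord_volume (F w)) has_derivative (\<lambda>X. P X + Q X)) (at x)"
    unfolding coord_volume_upd_add sum.distrib P_def[symmetric] Q_def[symmetric] .
  moreover have "(\<lambda>w. coord_volume (F w)) = (\<lambda>w. C * coord_volume Y)"
    unfolding F_def det ..
  ultimately have "(\<lambda>X. P X + Q X) = (\<lambda>X. 0)"
    using has_derivative_unique by (metis has_derivative_const)
  then have PQ: "P X + Q X = 0" for X by metis
  have "P (\<i> *s X) = \<i> * P X"
  proof -
    have "(\<chi> k. D (\<i> *s X) (Y j) (axis k 1)) = \<i> *s (\<chi> k. D X (Y j) (axis k 1))" for j
      by (simp add: vec_eq_iff D_scale)
    then show ?thesis by (simp add: P_def coord_volume_upd_smult sum_distrib_left)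
  qed
  moreover have "Q (\<i> *s X) = - \<i> * Q X"
  proof -
    have "(\<chi> k. cnj (D (\<i> *s X) (axis k 1) (Y j))) = (- \<i>) *s (\<chi> k. cnj (D X (axis k 1) (Y j)))" for j
      by (simp add: vec_eq_iff D_scale)
    then show ?thesis by (simp only: Q_def coord_volume_upd_smult sum_distrib_left)
  qed
  ultimately have "\<i> * (P X - Q X) = 0"
    using PQ[of "\<i> *s X"] by (simp add: algebra_simps)
  then have P0: "P X = 0" using PQ[of X] by (simp add: complex_eq_iff)
  have "\<exists>V. \<forall>Z. H x V Z = D X (Y j) Z" for j
    by (rule sesquilinear_represents[OF H pos, of "D X (Y j)"]) (auto simp: D_antilinear)
  then obtain V where V: "\<And>j Z. H x (V j) Z = D X (Y j) Z" by metis
  have \<Gamma>: "christoffel (\<lambda>w X Y. Re (H w X Y)) x X (Y j) = V j" for j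
    by (rule kaehler_christoffel[OF deriv sym H pos V])
  have "C * (\<Sum>j\<in>UNIV. coord_volume (Y(j := V j))) = P X"
  proof -
    have "(F x)(j := \<chi> k. D X (Y j) (axis k 1)) = (\<lambda>l. \<chi> k. H x ((Y(j := V j)) l) (axis k 1))" for j
      by (auto simp: fun_eq_iff F_def V)
    then show ?thesis unfolding P_def by (simp only: det sum_distrib_left)
  qed
  then have "(\<Sum>j\<in>UNIV. coord_volume (Y(j := V j))) = 0" using C P0 by simp
  then show ?thesis
    unfolding covariant_derivative_def \<Gamma> by (simp add: frechet_derivative_const sum_distrib_left[symmetric])
qed

lemma coord_volume_cnj: "coord_volume (\<lambda>k. \<chi> l. cnj (Y k $ l)) = cnj (coord_volume Y)"
  by (simp add: coord_volume_def det_def)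

lemma coord_volume_gram:
  "coord_volume (\<lambda>j. \<chi> k. herm (Y j) (Z k)) = coord_volume Y * cnj (coord_volume Z)"
proof -
  have "(\<chi> j k. herm (Y j) (Z k)) = (\<chi> j. Y j) ** transpose (\<chi> k l. cnj (Z k $ l))"
    by (simp add: vec_eq_iff matrix_matrix_mult_def transpose_def herm_def)
  then show ?thesis
    unfolding coord_volume_cnj[symmetric] by (simp add: coord_volume_def det_mul)
qed

section \<open>The derivative of the Calabi-Eguchi-Hanson metric\<close>

text \<open>The base component, which forgets the fibre coordinate \<open>t = w\<^sup>i\<close>.\<close>

definition horiz :: "'n::finite \<Rightarrow> complex ^ 'n \<Rightarrow> complex ^ 'n" where
  "horiz i x = x - x $ i *s axis i 1"

text \<open>\<open>\<partial>h/h\<close> for \<open>h = |\<zeta>|\<^sup>2\<close>\<close>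

definition log_partial :: "'n::finite \<Rightarrow> complex ^ 'n \<Rightarrow> complex ^ 'n \<Rightarrow> complex" where
  "log_partial i w x = herm (horiz i x) (affine_point i w) / herm (affine_point i w) (affine_point i w)"

lemma horiz_simps:
  "horiz i (x + y) = horiz i x + horiz i y" "horiz i (c *s x) = c *s horiz i x"
  "horiz i (axis i 1) = 0"
  by (simp_all add: horiz_def vec_eq_iff algebra_simps)

lemma herm_zero: "herm 0 y = 0" "herm x 0 = 0"
  by (simp_all add: herm_def)

lemma log_partial_simps:
  "log_partial i w (x + y) = log_partial i w x + log_partial i w y"
  "log_partial i w (c *s x) = c * log_partial i w x"
  "log_partial i w (axis i 1) = 0"
  by (simp_all add: log_partial_def horiz_simps herm_simps herm_zero add_divide_distrib)

lemma fibre_form_eq: "fibre_form i w x = x $ i / of_nat CARD('n) + w $ i * log_partial i w (x :: complex ^ 'n::finite)"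
  by (simp add: fibre_form_def log_partial_def horiz_def)

lemma fibre_form_simps:
  "fibre_form i w (x + y) = fibre_form i w x + fibre_form i w y"
  "fibre_form i w (c *s x) = c * fibre_form i w x"
  by (simp_all add: fibre_form_eq log_partial_simps add_divide_distrib algebra_simps)

lemma herm_affine_nz: "herm (affine_point i w) (affine_point i w) \<noteq> 0"
  by (simp add: herm_self)

lemma herm_self_cnj: "cnj (herm x x) = herm x x"
  by (rule herm_cnj)

lemma fs_horiz:
  "fs (affine_point i w) (horiz i x) (horiz i y) =
     herm (horiz i x) (horiz i y) / herm (affine_point i w) (affine_point i w)
     - log_partial i w x * cnj (log_partial i w y)"
  by (simp add: fs_def log_partial_def herm_cnj herm_self_cnj power2_eq_square)

lemma affine_point_horiz:
  "((\<lambda>w. affine_point i w $ j) has_derivative (\<lambda>x. horiz i x $ j)) (at w)"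
  unfolding horiz_def by (rule affine_point_deriv)

lemma herm_affine_deriv:
  "((\<lambda>w. herm y (affine_point i w)) has_derivative (\<lambda>x. herm y (horiz i x))) (at w)"
  unfolding herm_def
  by (intro has_derivative_sum has_derivative_mult_right has_derivative_cnj affine_point_horiz)

lemma herm_affine_self_deriv:
  "((\<lambda>w. herm (affine_point i w) (affine_point i w)) has_derivative
     (\<lambda>x. herm (affine_point i w) (affine_point i w) * (log_partial i w x + cnj (log_partial i w x)))) (at w)"
proof -
  have "((\<lambda>w. herm (affine_point i w) (affine_point i w)) has_derivative
     (\<lambda>x. \<Sum>j\<in>UNIV. affine_point i w $ j * cnj (horiz i x $ j) + horiz i x $ j * cnj (affine_point i w $ j))) (at w)"
    unfolding herm_def by (intro has_derivative_sum has_derivative_mult has_derivative_cnj affine_point_horiz)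
  moreover have "(\<Sum>j\<in>UNIV. affine_point i w $ j * cnj (horiz i x $ j) + horiz i x $ j * cnj (affine_point i w $ j))
     = herm (affine_point i w) (affine_point i w) * (log_partial i w x + cnj (log_partial i w x))" for x
    using herm_affine_nz[of i w]
    by (simp add: sum.distrib log_partial_def herm_cnj herm_self_cnj distrib_left) (simp add: herm_def)
  ultimately show ?thesis by simp
qed

lemma herm_affine_power_deriv:
  "((\<lambda>w. herm (affine_point i w) (affine_point i w) ^ m) has_derivative
     (\<lambda>x. of_nat m * herm (affine_point i w) (affine_point i w) ^ m * (log_partial i w x + cnj (log_partial i w x)))) (at w)"
  by (rule has_derivative_eq_rhs[OF has_derivative_power[OF herm_affine_self_deriv]])
     (cases m; auto simp: fun_eq_iff algebra_simps)

lemma log_partial_deriv: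
  "((\<lambda>w. log_partial i w y) has_derivative
     (\<lambda>x. herm (horiz i y) (horiz i x) / herm (affine_point i w) (affine_point i w)
       - log_partial i w y * (log_partial i w x + cnj (log_partial i w x)))) (at w)"
  unfolding log_partial_def[of i _ y]
  by (rule has_derivative_eq_rhs[OF has_derivative_divide[OF herm_affine_deriv herm_affine_self_deriv herm_affine_nz]])
     (use herm_affine_nz[of i w] in \<open>auto simp: fun_eq_iff field_simps\<close>)

lemma fs_deriv:
  fixes i :: "'n::finite"
  defines "B \<equiv> \<lambda>w x y. herm (horiz i x) (horiz i y) / herm (affine_point i w) (affine_point i w)"
    and "F \<equiv> \<lambda>w x y z. 2 * log_partial i w x * log_partial i w y * cnj (log_partial i w z)
      - log_partial i w x * (herm (horiz i y) (horiz i z) / herm (affine_point i w) (affine_point i w))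
      - log_partial i w y * (herm (horiz i x) (horiz i z) / herm (affine_point i w) (affine_point i w))"
  shows "((\<lambda>w. fs (affine_point i w) (horiz i y) (horiz i z)) has_derivative
     (\<lambda>x. F w x y z + cnj (F w x z y))) (at w)"
proof -
  have "((\<lambda>w. B w y z) has_derivative (\<lambda>x. - B w y z * (log_partial i w x + cnj (log_partial i w x)))) (at w)"
    unfolding B_def
    by (rule has_derivative_eq_rhs[OF has_derivative_divide[OF has_derivative_const herm_affine_self_deriv herm_affine_nz]])
       (use herm_affine_nz[of i w] in \<open>auto simp: fun_eq_iff field_simps\<close>)
  from has_derivative_diff[OF this has_derivative_mult[OF log_partial_deriv[of i y w, folded B_def]
      has_derivative_cnj[OF log_partial_deriv[of i z w, folded B_def]]]]
  have *: "((\<lambda>w. B w y z - log_partial i w y * cnj (log_partial i w z)) has_derivative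
     (\<lambda>x. F w x y z + cnj (F w x z y))) (at w)"
    by (rule has_derivative_eq_rhs)
       (auto simp: fun_eq_iff F_def B_def herm_cnj herm_self_cnj algebra_simps add_divide_distrib)
  show ?thesis unfolding fs_horiz using * by (simp add: B_def)
qed

lemma fibre_form_deriv:
  fixes w :: "complex ^ 'n::finite"
  shows "((\<lambda>w. fibre_form i w y) has_derivative
     (\<lambda>x. of_nat CARD('n) * (fibre_form i w x - w $ i * log_partial i w x) * log_partial i w y
       - w $ i * log_partial i w x * log_partial i w y
       + w $ i * cnj (fs (affine_point i w) (horiz i x) (horiz i y)))) (at w)"
proof -
  have "((\<lambda>w. fibre_form i w y) has_derivative
     (\<lambda>x. 0 + (w $ i * (herm (horiz i y) (horiz i x) / herm (affine_point i w) (affine_point i w)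
       - log_partial i w y * (log_partial i w x + cnj (log_partial i w x))) + x $ i * log_partial i w y))) (at w)"
    unfolding fibre_form_eq
    by (intro has_derivative_add has_derivative_const has_derivative_mult nth_deriv log_partial_deriv)
  then show ?thesis
    by (rule has_derivative_eq_rhs)
       (auto simp: fun_eq_iff fs_horiz fibre_form_eq herm_cnj herm_self_cnj algebra_simps)
qed

lemma ceh_radius_powr_deriv:
  fixes w :: "complex ^ 'n::finite"
  assumes a: "a > 0"
  shows "((\<lambda>w. complex_of_real (ceh_radius a i w powr r)) has_derivative
     (\<lambda>x. of_real (r * ceh_radius a i w powr (r - 1)) * (of_nat CARD('n) * herm (affine_point i w) (affine_point i w) ^ CARD('n) *
        (cnj (w $ i) * fibre_form i w x + w $ i * cnj (fibre_form i w x))))) (at w)"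
proof -
  let ?n = "CARD('n)"
  let ?h = "\<lambda>w. herm (affine_point i w) (affine_point i w)"
  let ?d = "\<lambda>x. of_nat ?n * ?h w ^ ?n * (cnj (w $ i) * fibre_form i w x + w $ i * cnj (fibre_form i w x))"
  have "((\<lambda>w. w $ i * cnj (w $ i) * ?h w ^ ?n) has_derivative ?d) (at w)"
    by (rule has_derivative_eq_rhs[OF has_derivative_mult[OF has_derivative_mult[OF nth_deriv has_derivative_cnj[OF nth_deriv]] herm_affine_power_deriv]])
       (auto simp: fun_eq_iff fibre_form_eq field_simps)
  from has_derivative_add[OF has_derivative_const[of "a ^ ?n"] has_derivative_Re[OF this]]
  have "(ceh_radius a i has_derivative (\<lambda>x. Re (?d x))) (at w)"
    by (simp add: ceh_radius_def[abs_def])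
  moreover have "((\<lambda>t. t powr r) has_derivative (\<lambda>v. (r * ceh_radius a i w powr (r - 1)) * v)) (at (ceh_radius a i w))"
    using has_real_derivative_powr[OF ceh_radius_pos[OF a, of i w], of r] unfolding has_field_derivative_def .
  ultimately have "((\<lambda>w. complex_of_real (ceh_radius a i w powr r)) has_derivative
      (\<lambda>x. of_real (r * ceh_radius a i w powr (r - 1) * Re (?d x)))) (at w)"
    by (intro has_derivative_of_real has_derivative_compose[where f = "ceh_radius a i" and g = "\<lambda>t. t powr r"])
  note D = this
  have R: "of_real (Re (?d x)) = ?d x" for x
  proof -
    have "cnj (?d x) = ?d x" by (simp add: herm_self_cnj algebra_simps)
    then show ?thesis by (simp only: Reals_cnj_iff[symmetric] of_real_Re)
  qed
  show ?thesis using D unfolding of_real_mult R .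
qed

text \<open>The derivative of the metric in a holomorphic direction \<open>x\<close>, with \<open>dt\<close> eliminated in favour of
  \<open>\<theta>\<close>, so that the Kaehler condition is visible as symmetry in \<open>x\<close> and \<open>y\<close>.\<close>

definition ceh_partial :: "real \<Rightarrow> 'n::finite \<Rightarrow> complex ^ 'n \<Rightarrow> complex ^ 'n \<Rightarrow> complex ^ 'n \<Rightarrow> complex ^ 'n \<Rightarrow> complex" where
  "ceh_partial a i w x y z = (let n = CARD('n); \<rho> = ceh_radius a i w; v = affine_point i w; h = herm v v;
     \<beta> = log_partial i w; \<theta> = fibre_form i w; f = (\<lambda>x y. fs v (horiz i x) (horiz i y)) in
     of_real (\<rho> powr (1 / n - 1)) * h ^ n * cnj (w $ i) * (\<theta> x * f y z + \<theta> y * f x z)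
     + of_real (\<rho> powr (1 / n)) * (2 * \<beta> x * \<beta> y * cnj (\<beta> z)
         - \<beta> x * (herm (horiz i y) (horiz i z) / h) - \<beta> y * (herm (horiz i x) (horiz i z) / h))
     + of_real ((1 / n - 1) * \<rho> powr (1 / n - 2)) * of_nat n * (h ^ n)\<^sup>2 * cnj (w $ i) * \<theta> x * \<theta> y * cnj (\<theta> z)
     + of_real (\<rho> powr (1 / n - 1)) * h ^ n *
         (of_nat n * (\<beta> x * \<theta> y + \<theta> x * \<beta> y) - (of_nat n + 1) * w $ i * \<beta> x * \<beta> y) * cnj (\<theta> z))"

lemma ceh_partial_sym: "ceh_partial a i w x y z = ceh_partial a i w y x z"
  unfolding ceh_partial_def Let_def by (simp add: algebra_simps)

lemma ceh_hermitian_deriv: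
  fixes w :: "complex ^ 'n::finite"
  assumes a: "a > 0"
  shows "((\<lambda>w. ceh_hermitian a i w y z) has_derivative
     (\<lambda>x. ceh_partial a i w x y z + cnj (ceh_partial a i w x z y))) (at w)"
proof -
  let ?n = "CARD('n)"
  let ?h = "\<lambda>w. herm (affine_point i w) (affine_point i w)"
  have fs_cnj: "cnj (fs (affine_point i w) x y) = fs (affine_point i w) y x" for x y :: "complex ^ 'n"
    by (simp add: fs_def herm_cnj mult.commute)
  define \<rho> where "\<rho> = ceh_radius a i w"
  define r1 r2 r3 where "r1 = complex_of_real (\<rho> powr (1 / ?n))" and "r2 = complex_of_real (\<rho> powr (1 / ?n - 1))"
    and "r3 = complex_of_real ((1 / ?n - 1) * \<rho> powr (1 / ?n - 2))"
  define h t \<beta> \<theta> f where "h = ?h w ^ ?n" and "t = w $ i" and "\<beta> = log_partial i w" and "\<theta> = fibre_form i w"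
    and "f = (\<lambda>x y. fs (affine_point i w) (horiz i x) (horiz i y))"
  note atoms = this
  have cnj_simps: "cnj r1 = r1" "cnj r2 = r2" "cnj r3 = r3" "cnj h = h" "cnj (f x y) = f y x" for x y
    by (simp_all add: r1_def r2_def r3_def h_def f_def herm_self_cnj fs_cnj)
  have R1: "((\<lambda>w. complex_of_real (ceh_radius a i w powr (1 / ?n))) has_derivative
      (\<lambda>x. r2 * h * (cnj t * \<theta> x + t * cnj (\<theta> x)))) (at w)"
    by (rule has_derivative_eq_rhs[OF ceh_radius_powr_deriv[OF a]])
       (simp add: fun_eq_iff r2_def \<rho>_def h_def t_def \<theta>_def)
  have R2: "((\<lambda>w. complex_of_real (ceh_radius a i w powr (1 / ?n - 1))) has_derivative
      (\<lambda>x. r3 * of_nat ?n * h * (cnj t * \<theta> x + t * cnj (\<theta> x)))) (at w)"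
    by (rule has_derivative_eq_rhs[OF ceh_radius_powr_deriv[OF a]])
       (simp add: fun_eq_iff r3_def \<rho>_def h_def t_def \<theta>_def diff_diff_eq)
  have D: "((\<lambda>w. ceh_hermitian a i w y z) has_derivative (\<lambda>x.
     r1 * ((2 * \<beta> x * \<beta> y * cnj (\<beta> z) - \<beta> x * (f y z + \<beta> y * cnj (\<beta> z)) - \<beta> y * (f x z + \<beta> x * cnj (\<beta> z)))
       + cnj (2 * \<beta> x * \<beta> z * cnj (\<beta> y) - \<beta> x * (f z y + \<beta> z * cnj (\<beta> y)) - \<beta> z * (f x y + \<beta> x * cnj (\<beta> y))))
     + r2 * h * (cnj t * \<theta> x + t * cnj (\<theta> x)) * f y z
     + (r2 * h * \<theta> y * cnj (of_nat ?n * (\<theta> x - t * \<beta> x) * \<beta> z - t * \<beta> x * \<beta> z + t * cnj (f x z))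
       + (r2 * h * (of_nat ?n * (\<theta> x - t * \<beta> x) * \<beta> y - t * \<beta> x * \<beta> y + t * cnj (f x y))
         + (r2 * (of_nat ?n * h * (\<beta> x + cnj (\<beta> x))) + r3 * of_nat ?n * h * (cnj t * \<theta> x + t * cnj (\<theta> x)) * h) * \<theta> y) * cnj (\<theta> z)))) (at w)"
  proof -
    have eq: "ceh_hermitian a i w y z = of_real (ceh_radius a i w powr (1 / ?n)) * fs (affine_point i w) (horiz i y) (horiz i z)
      + of_real (ceh_radius a i w powr (1 / ?n - 1)) * ?h w ^ ?n * fibre_form i w y * cnj (fibre_form i w z)" for w
      by (simp add: ceh_hermitian_def horiz_def)
    have B: "herm (horiz i x) (horiz i y) / ?h w = f x y + \<beta> x * cnj (\<beta> y)" for x y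
      by (simp add: f_def fs_horiz \<beta>_def)
    note D = has_derivative_add[OF has_derivative_mult[OF R1 fs_deriv[of i y z w, unfolded B]]
       has_derivative_mult[OF has_derivative_mult[OF has_derivative_mult[OF R2 herm_affine_power_deriv] fibre_form_deriv[of i y w]]
         has_derivative_cnj[OF fibre_form_deriv[of i z w]]]]
    show ?thesis
      unfolding eq by (rule has_derivative_eq_rhs[OF D]) (simp only: atoms r1_def r2_def \<rho>_def)
  qed
  have P: "ceh_partial a i w x y z =
      r2 * h * cnj t * (\<theta> x * f y z + \<theta> y * f x z)
     + r1 * (2 * \<beta> x * \<beta> y * cnj (\<beta> z) - \<beta> x * (f y z + \<beta> y * cnj (\<beta> z)) - \<beta> y * (f x z + \<beta> x * cnj (\<beta> z)))
     + r3 * of_nat ?n * h\<^sup>2 * cnj t * \<theta> x * \<theta> y * cnj (\<theta> z)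
     + r2 * h * (of_nat ?n * (\<beta> x * \<theta> y + \<theta> x * \<beta> y) - (of_nat ?n + 1) * t * \<beta> x * \<beta> y) * cnj (\<theta> z)" for x y z
    unfolding ceh_partial_def Let_def atoms r1_def r2_def r3_def \<rho>_def fs_horiz by simp
  show ?thesis
    by (rule has_derivative_eq_rhs[OF D], rule ext)
       (simp add: P cnj_simps algebra_simps power2_eq_square)
qed

lemma ceh_partial_simps:
  "ceh_partial a i w (c *s x) y z = c * ceh_partial a i w x y z"
  "ceh_partial a i w x y (z + z') = ceh_partial a i w x y z + ceh_partial a i w x y z'"
  "ceh_partial a i w x y (c *s z) = cnj c * ceh_partial a i w x y z"
proof -
  have fs: "fs v (x + x') y = fs v x y + fs v x' y" "fs v (c *s x) y = c * fs v x y"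
    "fs v x (y + y') = fs v x y + fs v x y'" "fs v x (c *s y) = cnj c * fs v x y" for v x x' y y' :: "complex ^ 'a" and c
    by (simp_all add: fs_def herm_simps add_divide_distrib algebra_simps)
  show "ceh_partial a i w (c *s x) y z = c * ceh_partial a i w x y z"
    unfolding ceh_partial_def Let_def fibre_form_simps fs horiz_simps herm_simps log_partial_simps
    by (simp add: algebra_simps)
  show "ceh_partial a i w x y (z + z') = ceh_partial a i w x y z + ceh_partial a i w x y z'"
    unfolding ceh_partial_def Let_def fibre_form_simps fs horiz_simps herm_simps log_partial_simps add_divide_distrib complex_cnj_add
    by (simp add: algebra_simps)
  show "ceh_partial a i w x y (c *s z) = cnj c * ceh_partial a i w x y z"
    unfolding ceh_partial_def Let_def fibre_form_simps fs horiz_simps herm_simps log_partial_simps complex_cnj_mult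
    by (simp add: algebra_simps)
qed

section \<open>Its determinant\<close>

lemma ceh_hermitian_factor:
  fixes w :: "complex ^ 'n::finite"
  assumes a: "a > 0"
  obtains T d where "\<And>x y. T (x + y) = T x + T y" "\<And>c x. T (c *s x) = c *s T x"
    "\<And>x y. ceh_hermitian a i w x y = herm (T x) (T y)"
    "\<And>Y :: 'n \<Rightarrow> complex ^ 'n. coord_volume (\<lambda>k. T (Y k)) = d * coord_volume Y" "d * cnj d = 1 / (of_nat CARD('n))\<^sup>2"
proof -
  let ?n = "CARD('n)"
  define v where "v = affine_point i w"
  define h where "h = (norm v)\<^sup>2"
  define \<rho> where "\<rho> = ceh_radius a i w"
  define l m where "l = sqrt (\<rho> powr (1 / ?n) / h)" and "m = sqrt (\<rho> powr (1 / ?n - 1) * h ^ (?n - 1))"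
  have h0: "h > 0" by (simp add: h_def v_def)
  have \<rho>0: "\<rho> > 0" unfolding \<rho>_def using a by (rule ceh_radius_pos)
  have hv: "herm v v = of_real h" unfolding h_def by (rule herm_self)
  have l0: "l > 0" using h0 \<rho>0 by (simp add: l_def)
  have l2: "l\<^sup>2 * h = \<rho> powr (1 / ?n)" and m2: "m\<^sup>2 = \<rho> powr (1 / ?n - 1) * h ^ (?n - 1)"
    using h0 \<rho>0 by (simp_all add: l_def m_def)
  have hpow: "h ^ (?n - 1) * h = h ^ ?n"
    by (metis One_nat_def Suc_pred power_Suc2 zero_less_card_finite)
  \<comment> \<open>\<open>T x = l (x - (\<partial>h/h)(x) v) + m \<theta>(x) v\<close>, a sum of a vector orthogonal to \<open>v\<close> and a multiple of \<open>v\<close>,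
    brought into the form required by \<open>coord_volume_shear\<close>\<close>
  define \<phi> where "\<phi> x = (of_real m * fibre_form i w x - of_real l * log_partial i w x) / of_real l" for x
  define T where "T x = of_real l *s (x - x $ i *s axis i 1 + \<phi> x *s v)" for x
  define d where "d = complex_of_real (l ^ ?n * (m / (?n * l)))"
  have \<phi>: "\<phi> (x + y) = \<phi> x + \<phi> y" "\<phi> (c *s x) = c * \<phi> x" for c x y
    using l0 by (simp_all add: \<phi>_def fibre_form_simps log_partial_simps field_simps)
  have "T (x + y) = T x + T y" "T (c *s x) = c *s T x" for c x y
    by (simp_all add: T_def \<phi> vec_eq_iff algebra_simps)
  moreover have "ceh_hermitian a i w x y = herm (T x) (T y)" for x y
  proof -
    have T: "T x = of_real l *s (horiz i x - log_partial i w x *s v) + (of_real m * fibre_form i w x) *s v" for x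
      using l0 by (simp add: T_def \<phi>_def horiz_def vec_eq_iff field_simps)
    have orth: "herm (horiz i x - log_partial i w x *s v) v = 0" for x
      using h0 by (simp add: herm_simps log_partial_def v_def[symmetric] hv)
    have orth': "herm v (horiz i x - log_partial i w x *s v) = 0" for x
      by (metis orth herm_cnj complex_cnj_zero)
    have fs: "herm (horiz i x - log_partial i w x *s v) (horiz i y - log_partial i w y *s v) = of_real h * fs v (horiz i x) (horiz i y)"
    proof -
      have "herm (horiz i x - log_partial i w x *s v) (horiz i y - log_partial i w y *s v)
        = herm (horiz i x - log_partial i w x *s v) (horiz i y)"
        using orth[of x] by (simp only: herm_simps(4,6)) simp
      also have "\<dots> = of_real h * fs v (horiz i x) (horiz i y)"
        using h0 by (simp add: herm_simps fs_def log_partial_def v_def[symmetric] hv field_simps power2_eq_square)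
      finally show ?thesis .
    qed
    have "herm (T x) (T y) = of_real (l\<^sup>2 * h) * fs v (horiz i x) (horiz i y)
        + of_real (m\<^sup>2 * h) * fibre_form i w x * cnj (fibre_form i w y)"
      unfolding T herm_simps(1-4) orth orth' fs hv
      by (simp add: power2_eq_square algebra_simps)
    also have "m\<^sup>2 * h = \<rho> powr (1 / ?n - 1) * h ^ ?n"
      unfolding m2 hpow[symmetric] by simp
    finally show ?thesis
      unfolding ceh_hermitian_def l2 \<rho>_def[symmetric] v_def[symmetric] hv horiz_def by simp
  qed
  moreover have "coord_volume (\<lambda>k. T (Y k)) = d * coord_volume Y" for Y :: "'n \<Rightarrow> complex ^ 'n"
  proof -
    have "\<phi> (axis i 1) = of_real (m / (?n * l))"
      by (simp add: \<phi>_def log_partial_simps fibre_form_eq)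
    then show ?thesis
      unfolding T_def coord_volume_smult d_def
      by (subst coord_volume_shear) (simp_all add: \<phi> v_def)
  qed
  moreover have "d * cnj d = 1 / (of_nat ?n)\<^sup>2"
  proof -
    have "(l ^ ?n * (m / (?n * l)))\<^sup>2 = (l\<^sup>2) ^ ?n * m\<^sup>2 / (real ?n ^ 2 * l\<^sup>2)"
      by (simp add: power_mult_distrib power_divide power_mult[symmetric] mult.commute)
    also have "(l\<^sup>2) ^ ?n = \<rho> / h ^ ?n"
    proof -
      have "l\<^sup>2 = \<rho> powr (1 / ?n) / h" using l2 h0 by (simp add: field_simps)
      then show ?thesis using \<rho>0 by (simp add: power_divide powr_power)
    qed
    also have "l\<^sup>2 = \<rho> powr (1 / ?n) / h" using l2 h0 by (simp add: field_simps)
    also have "m\<^sup>2 = \<rho> powr (1 / ?n) / \<rho> * h ^ (?n - 1)" unfolding m2 using \<rho>0 by (simp add: powr_diff)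
    also have "\<rho> / h ^ ?n * (\<rho> powr (1 / ?n) / \<rho> * h ^ (?n - 1)) / (real ?n ^ 2 * (\<rho> powr (1 / ?n) / h)) = 1 / (real ?n)\<^sup>2"
      using h0 \<rho>0 by (simp add: hpow[symmetric] field_simps)
    finally have "(l ^ ?n * (m / (?n * l)))\<^sup>2 = 1 / (real ?n)\<^sup>2" .
    then have "complex_of_real ((l ^ ?n * (m / (?n * l)))\<^sup>2) = of_real (1 / (real ?n)\<^sup>2)" by simp
    then show ?thesis
      unfolding d_def complex_cnj_complex_of_real power2_eq_square of_real_mult[symmetric] by simp
  qed
  ultimately show ?thesis by (rule that)
qed

lemma ceh_hermitian_sesquilinear: "a > 0 \<Longrightarrow> sesquilinear (ceh_hermitian a i w)"
  by (rule ceh_hermitian_factor[of a i w]) (simp_all add: sesquilinear_def herm_simps)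

lemma ceh_hermitian_det:
  fixes Y :: "'n::finite \<Rightarrow> complex ^ 'n"
  assumes "a > 0"
  shows "coord_volume (\<lambda>j. \<chi> k. ceh_hermitian a i w (Y j) (axis k 1)) = 1 / (of_nat CARD('n))\<^sup>2 * coord_volume Y"
proof -
  obtain T d where T: "\<And>x y. ceh_hermitian a i w x y = herm (T x) (T y)"
    and vol: "\<And>Y :: 'n \<Rightarrow> complex ^ 'n. coord_volume (\<lambda>k. T (Y k)) = d * coord_volume Y"
    and d: "d * cnj d = 1 / (of_nat CARD('n))\<^sup>2"
    using ceh_hermitian_factor[OF assms, of i w] by metis
  show ?thesis
    unfolding T coord_volume_gram[of "\<lambda>j. T (Y j)" "\<lambda>k. T (axis k 1)"] vol coord_volume_axis d[symmetric]
    by simp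
qed

lemma ceh_volume_parallel:
  assumes "a > 0"
  shows "covariant_derivative (\<lambda>w x y. Re (ceh_hermitian a i w x y)) (\<lambda>w Y. b * coord_volume Y) w x Y = 0"
  by (rule kaehler_volume_parallel[OF ceh_hermitian_deriv[OF assms] ceh_partial_sym ceh_partial_simps
      ceh_hermitian_sesquilinear[OF assms] ceh_hermitian_pos[OF assms] ceh_hermitian_det[OF assms]]) simp_all

section \<open>Uniqueness of the metric\<close>

lemma total_point_off_zero:
  assumes "w $ i \<noteq> 0"
  shows "total_point i w \<in> total_space - zero_section"
proof -
  have "total_point i w \<in> total_space"
    using total_point_in[of i w i] by (simp add: chart_domain_def split: prod.splits)
  moreover have "fst (total_point i w) $ i \<noteq> 0" using assms by (simp add: total_point_def)
  ultimately show ?thesis by (auto simp: zero_section_def)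
qed

lemma blowdown_off_zero:
  fixes w :: "complex ^ 'n::finite"
  assumes "w $ i \<noteq> 0"
  obtains d where "d \<in> quotient_atlas" "blowdown (total_point i w) \<in> fst d"
proof -
  have "exp (Ln (w $ i) / of_nat CARD('n)) ^ CARD('n) = w $ i"
    using assms by (simp add: exp_of_nat_mult[symmetric])
  then obtain s where s: "s ^ CARD('n) = w $ i" by blast
  then have "s \<noteq> 0" using assms by (auto simp: power_0_left)
  then have "s *s affine_point i w \<noteq> 0" by (metis affine_point_nz vector_mul_eq_0)
  then have "blowdown (total_point i w) \<in> punctured_quotient"
    unfolding blowdown_total_point[OF s] punctured_quotient_def mu_class_def by (intro quotientI) simp
  then show ?thesis unfolding quotient_atlas_covers[symmetric] using that by blast
qed

lemma ceh_metric_eq: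
  fixes g :: "((complex ^ 'n::finite) \<times> (complex ^ 'n) set, 'n) metric"
  assumes a: "a > 0" and g: "ceh_metric a g"
  shows "g (chart_domain i, chart_coord i) w x y = Re (ceh_hermitian a i w x y)"
proof -
  let ?c = "(chart_domain i, chart_coord i)"
  let ?f = "\<lambda>w. g ?c w x y - Re (ceh_hermitian a i w x y)"
  have c: "?c \<in> total_atlas" by (simp add: total_atlas_def)
  have off_zero: "?f w = 0" if w: "w $ i \<noteq> 0" for w
  proof -
    obtain d where d: "d \<in> quotient_atlas" "blowdown (total_point i w) \<in> fst d"
      using blowdown_off_zero[OF w] .
    have p: "total_point i w \<in> (total_space - zero_section) \<inter> fst ?c"
      using total_point_off_zero[OF w] total_point_in[of i w i] by simp
    have "g ?c (snd ?c (total_point i w)) x y = ceh_chart a ?c (snd ?c (total_point i w)) x y"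
      using g ceh_chart_pullback[OF a] c d p unfolding ceh_metric_def metric_pullback_on_def by metis
    then show ?thesis by simp
  qed
  have "smooth_on UNIV (\<lambda>w. g ?c w x y)"
    using g c unfolding ceh_metric_def riemannian_metric_def by (metis chart_image_total)
  then have "(\<lambda>w. g ?c w x y) differentiable at w" for w
    by (cases rule: smooth_on.cases) auto
  then have "isCont (\<lambda>w. g ?c w x y) w" for w
    by (rule differentiable_imp_continuous_within)
  moreover have "isCont (\<lambda>w. Re (ceh_hermitian a i w x y)) w" for w
    by (intro continuous_Re has_derivative_continuous[OF ceh_hermitian_deriv[OF a]])
  ultimately have cont: "isCont ?f w" for w by (rule continuous_diff)
  have "?f w = 0"
  proof (cases "w $ i = 0")
    case True
    have "isCont (\<lambda>r :: real. ?f (w + r *\<^sub>R axis i 1)) 0"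
      by (rule isCont_o2[where g = ?f]) (auto intro!: continuous_intros cont)
    then have "((\<lambda>r. ?f (w + r *\<^sub>R axis i 1)) \<longlongrightarrow> ?f w) (at 0)" by (simp add: isCont_def)
    moreover have "\<forall>\<^sub>F r in at (0 :: real). ?f (w + r *\<^sub>R axis i 1) = 0"
      unfolding eventually_at_filter using off_zero True by (intro always_eventually) auto
    then have "((\<lambda>r. ?f (w + r *\<^sub>R axis i 1)) \<longlongrightarrow> 0) (at 0)" by (rule tendsto_eventually)
    ultimately show ?thesis by (rule LIM_unique)
  qed (rule off_zero)
  then show ?thesis by simp
qed

section \<open>The volume form\<close>

text \<open>Since \<open>z = t\<^bsup>1/n\<^esup> \<zeta>\<close>, the Jacobian determinant of the blow-down map is \<open>(t\<^bsup>1/n\<^esup>)\<^sup>n / (n t) = 1/n\<close>.\<close>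

definition ceh_volume :: "((complex ^ 'n::finite) \<times> (complex ^ 'n) set, 'n) form" where
  "ceh_volume c w Y = 1 / of_nat CARD('n) * coord_volume Y"

lemma ceh_volume_transition:
  "form_pullback_on UNIV total_atlas total_atlas id ceh_volume (ceh_volume :: (_, 'n::finite) form)"
  unfolding form_pullback_on_def
proof (intro ballI impI allI)
  fix c d and p :: "(complex ^ 'n) \<times> (complex ^ 'n) set" and Y
  assume c: "c \<in> total_atlas" and d: "d \<in> total_atlas" and p: "p \<in> UNIV \<inter> fst c" "id p \<in> fst d"
  let ?n = "CARD('n)"
  from c d obtain i k where ik: "c = (chart_domain i, chart_coord i)" "d = (chart_domain k, chart_coord k)"
    by (auto simp: total_atlas_def)
  define w where "w = chart_coord i p"
  define v where "v = affine_point i w"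
  have pw: "p = total_point i w" using p by (simp add: ik w_def total_point_chart)
  have nz: "affine_point i w $ k \<noteq> 0" using p by (simp add: ik pw total_point_in)
  then have vk: "v $ k \<noteq> 0" by (simp add: v_def)
  define L where "L = local_diff c d id p"
  have L: "L = (\<lambda>x. \<chi> j. if j = k then x $ i * v $ k ^ ?n + w $ i * (of_nat ?n * v $ k ^ (?n - 1) * horiz i x $ k)
       else horiz i x $ j / v $ k - v $ j * horiz i x $ k / (v $ k)\<^sup>2)"
    unfolding L_def local_diff_def ik snd_conv w_def[symmetric] frechet_derivative_at[OF total_transition[OF nz], symmetric]
      horiz_def v_def ..
  define \<phi> where "\<phi> x = x $ i * v $ k ^ ?n + (w $ i * (of_nat ?n * v $ k ^ (?n - 1)) - 1 / v $ k) * horiz i x $ k" for x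
  \<comment> \<open>Composing \<open>L\<close> with the determinant 1 map \<open>e\<^sub>k \<mapsto> v / v\<^sub>k\<close> makes it a multiple of a shear.\<close>
  have "L x - L x $ k *s axis k 1 + L x $ k *s ((1 / v $ k) *s v) = (1 / v $ k) *s (x - x $ i *s axis i 1 + \<phi> x *s v)" for x
    unfolding horiz_def[of i, symmetric] using vk by (auto simp: L \<phi>_def vec_eq_iff axis_def field_simps power2_eq_square)
  then have "coord_volume (\<lambda>l. L (Y l)) = coord_volume (\<lambda>l. (1 / v $ k) *s (Y l - Y l $ i *s axis i 1 + \<phi> (Y l) *s v))"
    using coord_volume_shear[of "\<lambda>x. x $ k" "(1 / v $ k) *s v" k "\<lambda>l. L (Y l)"] vk by simp
  also have "\<dots> = coord_volume Y"
    unfolding coord_volume_smult using vk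
    by (subst coord_volume_shear) (simp_all add: \<phi>_def v_def horiz_simps field_simps)
  finally show "ceh_volume c (snd c p) Y = ceh_volume d (snd d (id p)) (\<lambda>k. local_diff c d id p (Y k))"
    unfolding L_def[symmetric] ceh_volume_def by simp
qed

lemma ceh_volume_blowdown:
  "form_pullback_on (total_space - zero_section) total_atlas quotient_atlas blowdown
     ceh_volume (standard_volume :: (_, 'n::finite) form)"
  unfolding form_pullback_on_def
proof (intro ballI impI allI)
  fix c d and p :: "(complex ^ 'n) \<times> (complex ^ 'n) set" and Y
  assume c: "c \<in> total_atlas" and d: "d \<in> quotient_atlas"
    and p: "p \<in> (total_space - zero_section) \<inter> fst c" and q: "blowdown p \<in> fst d"
  from c obtain i where i: "c = (chart_domain i, chart_coord i)" by (auto simp: total_atlas_def)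
  define w where "w = chart_coord i p"
  have pw: "p = total_point i w" using p by (simp add: i w_def total_point_chart)
  have t: "w $ i \<noteq> 0"
  proof
    assume "w $ i = 0"
    then have "fst p = 0" by (simp add: pw total_point_def vec_eq_iff)
    then show False using p by (auto simp: zero_section_def)
  qed
  obtain s where s: "s ^ CARD('n) = w $ i"
    and der: "(local_rep c d blowdown has_derivative
      (\<lambda>x. s *s (x - x $ i *s axis i 1) + (s * (x $ i / (of_nat CARD('n) * w $ i))) *s affine_point i w)) (at w)"
    using blowdown_local_rep[OF d t, folded pw i] q by blast
  have "local_diff c d blowdown p =
      (\<lambda>x. s *s (x - x $ i *s axis i 1 + (x $ i / (of_nat CARD('n) * w $ i)) *s affine_point i w))"
    unfolding local_diff_def using der by (simp add: i flip: w_def frechet_derivative_at)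
  then have "coord_volume (\<lambda>k. local_diff c d blowdown p (Y k)) =
      s ^ CARD('n) * (axis i 1 $ i / (of_nat CARD('n) * w $ i) * coord_volume Y)"
    by (simp only: coord_volume_smult)
      (subst coord_volume_shear, simp_all add: add_divide_distrib)
  then show "ceh_volume c (snd c p) Y = standard_volume d (snd d (blowdown p)) (\<lambda>k. local_diff c d blowdown p (Y k))"
    using t by (simp add: ceh_volume_def standard_volume_def s)
qed

lemma quotient_chart_deriv:
  fixes x :: "complex ^ 'n::finite"
  assumes d: "d \<in> quotient_atlas" and x: "mu_class x \<in> fst d"
  obtains e where "e ^ CARD('n) = 1" "((\<lambda>y. snd d (mu_class y)) has_derivative (\<lambda>v. e *s v)) (at x)"
proof -
  from d obtain W where W: "d = (mu_class ` W, inv_into W mu_class)" "open W" "inj_on mu_class W"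
    by (auto simp: quotient_atlas_def)
  from x W(1) obtain y where y: "y \<in> W" "mu_class x = mu_class y" by auto
  then obtain e where e: "e ^ CARD('n) = 1" "y = e *s x" by (auto simp: mu_class_eq_iff)
  have lin: "bounded_linear (\<lambda>x :: complex ^ 'n. e *s x)"
    by (intro linear_conv_bounded_linear[THEN iffD1] linearI) (simp_all add: vec_eq_iff algebra_simps)
  have open': "open ((\<lambda>x. e *s x) -` W)"
    using W(2) lin by (intro open_vimage) (auto simp: linear_continuous_on)
  have "e *s u = snd d (mu_class u)" if "u \<in> (\<lambda>x. e *s x) -` W" for u
    using that W mu_class_scale[OF e(1), of u] by (metis inv_into_f_f snd_conv vimageE)
  moreover have "x \<in> (\<lambda>x. e *s x) -` W" using e(2) y(1) by simp
  ultimately have "((\<lambda>y. snd d (mu_class y)) has_derivative (\<lambda>v. e *s v)) (at x)"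
    by (intro has_derivative_transform_within_open[OF bounded_linear_imp_has_derivative[OF lin] open'])
  with e(1) show ?thesis by (rule that)
qed

lemma standard_volume_quotient:
  "form_pullback_on UNIV quotient_atlas quotient_atlas id standard_volume (standard_volume :: (_, 'n::finite) form)"
  unfolding form_pullback_on_def
proof (intro ballI impI allI)
  fix c d and p :: "(complex ^ 'n) set" and Y
  assume c: "c \<in> quotient_atlas" and d: "d \<in> quotient_atlas" and p: "p \<in> UNIV \<inter> fst c" "id p \<in> fst d"
  from c obtain V where V: "c = (mu_class ` V, inv_into V mu_class)" "open V" "inj_on mu_class V"
    by (auto simp: quotient_atlas_def)
  from p(1) V(1) obtain x where x: "x \<in> V" "p = mu_class x" by auto
  have cx: "snd c p = x" using x V by simp
  obtain e where e: "e ^ CARD('n) = 1" "((\<lambda>y. snd d (mu_class y)) has_derivative (\<lambda>v. e *s v)) (at x)"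
    using quotient_chart_deriv[OF d, of x] p(2) x(2) by auto
  have "(local_rep c d id has_derivative (\<lambda>v. e *s v)) (at x)"
    by (rule has_derivative_transform_within_open[OF e(2) V(2) x(1)])
       (simp add: local_rep_def V(1) quotient_chart_point[OF V(3)])
  then have "local_diff c d id p = (\<lambda>v. e *s v)"
    unfolding local_diff_def cx by (rule frechet_derivative_at[symmetric])
  then show "standard_volume c (snd c p) Y = standard_volume d (snd d (id p)) (\<lambda>k. local_diff c d id p (Y k))"
    by (simp add: standard_volume_def coord_volume_smult e(1))
qed

lemma standard_volume_descends:
  "form_pullback_on (- {0}) punctured_atlas quotient_atlas mu_class standard_volume
     (standard_volume :: (_, 'n::finite) form)"
  unfolding form_pullback_on_def
proof (intro ballI impI allI)
  fix c d and x :: "complex ^ 'n" and Y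
  assume c: "c \<in> punctured_atlas" and d: "d \<in> quotient_atlas" and x: "x \<in> - {0} \<inter> fst c" "mu_class x \<in> fst d"
  have c_eq: "c = (- {0}, id)" using c by (simp add: punctured_atlas_def)
  obtain e where e: "e ^ CARD('n) = 1" "((\<lambda>y. snd d (mu_class y)) has_derivative (\<lambda>v. e *s v)) (at x)"
    using quotient_chart_deriv[OF d x(2)] .
  have "(local_rep c d mu_class has_derivative (\<lambda>v. e *s v)) (at x)"
  proof (rule has_derivative_transform_within_open[OF e(2), of "- {0}"])
    fix y :: "complex ^ 'n" assume "y \<in> - {0}"
    then have "inv_into (- {0}) id y = y" using inv_into_f_f[of id "- {0}" y] by simp
    then show "snd d (mu_class y) = local_rep c d mu_class y"
      by (simp add: local_rep_def chart_point_def c_eq)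
  qed (use x in auto)
  then have "local_diff c d mu_class x = (\<lambda>v. e *s v)"
    unfolding local_diff_def by (simp add: c_eq frechet_derivative_at[symmetric])
  then show "standard_volume c (snd c x) Y = standard_volume d (snd d (mu_class x)) (\<lambda>k. local_diff c d mu_class x (Y k))"
    by (simp add: standard_volume_def coord_volume_smult e(1))
qed

lemma holomorphic_fun_on_const: "holomorphic_fun_on S (\<lambda>_. b)"
  by (rule holomorphic_fun_onI[of _ _ "\<lambda>_ _. 0"]) auto

theorem proposition8:
  assumes "2 \<le> CARD('n::finite)"
  shows "\<exists>\<eta>q :: ((complex ^ 'n) set, 'n) form.
     holomorphic_volume_form quotient_atlas \<eta>q \<and>
     form_pullback_on (- {0}) punctured_atlas quotient_atlas mu_class standard_volume \<eta>q \<and>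
     (\<exists>\<eta> :: ((complex ^ 'n) \<times> (complex ^ 'n) set, 'n) form.
        form_pullback_on (total_space - zero_section) total_atlas quotient_atlas blowdown \<eta> \<eta>q \<and>
        holomorphic_volume_form total_atlas \<eta> \<and>
        nowhere_vanishing total_atlas \<eta> \<and>
        (\<forall>a > 0. \<forall>g. ceh_metric a g \<longrightarrow> parallel total_atlas g \<eta>))"
proof (rule exI[of _ standard_volume], intro conjI exI[of _ ceh_volume] allI impI)
  have "\<exists>f. holomorphic_fun_on S f \<and> (\<forall>x\<in>S. \<forall>Y. standard_volume c x Y = f x * coord_volume Y)"
    for S and c :: "((complex ^ 'n) set, complex ^ 'n) chart"
    by (intro exI[of _ "\<lambda>_. 1"]) (simp add: holomorphic_fun_on_const standard_volume_def)
  then show "holomorphic_volume_form quotient_atlas (standard_volume :: (_, 'n) form)"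
    unfolding holomorphic_volume_form_def using standard_volume_quotient by blast
  have "\<exists>f. holomorphic_fun_on S f \<and> (\<forall>x\<in>S. \<forall>Y. ceh_volume c x Y = f x * coord_volume Y)"
    for S and c :: "((complex ^ 'n) \<times> (complex ^ 'n) set, complex ^ 'n) chart"
    by (intro exI[of _ "\<lambda>_. 1 / of_nat CARD('n)"]) (simp add: holomorphic_fun_on_const ceh_volume_def)
  then show "holomorphic_volume_form total_atlas (ceh_volume :: (_, 'n) form)"
    unfolding holomorphic_volume_form_def using ceh_volume_transition by blast
  show "nowhere_vanishing total_atlas (ceh_volume :: (_, 'n) form)"
    unfolding nowhere_vanishing_def ceh_volume_def
    by (intro ballI exI[of _ "\<lambda>k. axis k 1"]) (simp add: coord_volume_axis)
  fix a :: real and g :: "((complex ^ 'n) \<times> (complex ^ 'n) set, 'n) metric"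
  assume a: "0 < a" and g: "ceh_metric a g"
  have "covariant_derivative (g (chart_domain i, chart_coord i)) (ceh_volume (chart_domain i, chart_coord i)) w X Y = 0"
    for i w X Y
    unfolding ceh_volume_def[abs_def] ceh_metric_eq[OF a g, abs_def] by (rule ceh_volume_parallel[OF a])
  then show "parallel total_atlas g ceh_volume"
    by (auto simp: parallel_def total_atlas_def)
qed (rule standard_volume_descends ceh_volume_blowdown)+

end
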